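(* Let $k\ge 3$ and $1\le j \le k-1$ be integers. Consider the random $k$-uniform hypergraph process on vertex set $[n]$, and let $\tau_C$ be the hitting time for $j$-connectivity and $\tau_I$ the time-step at which the last isolated $j$-set disappears. Then with probability tending to $1$ as $n\to\infty$, $\tau_C=\tau_I$.
   Context: The $k$-uniform random hypergraph process $\{\mathcal{H}^k(n,M)\}_M$ on vertex set $[n]=\{1,\dots,n\}$ starts with no edges, and in each step adds as an edge a $k$-set chosen uniformly at random among all $k$-sets that are not yet edges. A $j$-set is a set of $j$ distinct vertices; it is isolated if it is contained in no edge. Two $j$-sets $J,J'$ are $j$-connected if there is a sequence of edges $e_1,\dots,e_m$ with $J\subset e_1$, $J'\subset e_m$ and $|e_i\cap e_{i+1}|\ge j$ for all $1\le i\le m-1$. The hypergraph is $j$-connected if every two $j$-sets are $j$-connected. $\tau_C$ is the minimal $M$ such that $\mathcal{H}^k(n,M)$ is $j$-connected, and $\tau_I$ is the minimal $M$ such that $\mathcal{H}^k(n,M)$ has no isolated $j$-set. *)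

theory Defs
  imports "HOL-Probability.Probability"
begin

definition sets_of_size :: "nat \<Rightarrow> nat \<Rightarrow> nat set set" where
  "sets_of_size n i = {S. S \<subseteq> {1..n} \<and> card S = i}"

text \<open>
  The law of the list of the first \<open>M\<close> edges, in the order in which they are added. The set of
  available \<open>k\<close>-sets is nonempty at every step as long as \<open>M \<le> n choose k\<close>; the definition is
  only meant for such \<open>M\<close>.
\<close>

primrec first_edges :: "nat \<Rightarrow> nat \<Rightarrow> nat \<Rightarrow> nat set list pmf" where
  "first_edges k n 0 = return_pmf []"
| "first_edges k n (Suc M) =
     bind_pmf (first_edges k n M)
       (\<lambda>es. map_pmf (\<lambda>e. es @ [e]) (pmf_of_set (sets_of_size n k - set es)))"

definition hypergraph_process :: "nat \<Rightarrow> nat \<Rightarrow> nat set list pmf" where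
  "hypergraph_process k n = first_edges k n (n choose k)"

text \<open>The edge set of the hypergraph after \<open>M\<close> steps of the run \<open>es\<close> of the process.\<close>

definition edges_at :: "nat set list \<Rightarrow> nat \<Rightarrow> nat set set" where
  "edges_at es M = set (take M es)"

definition isolated :: "nat set set \<Rightarrow> nat set \<Rightarrow> bool" where
  "isolated E J \<longleftrightarrow> \<not> (\<exists>e\<in>E. J \<subseteq> e)"

definition j_connected_sets :: "nat \<Rightarrow> nat set set \<Rightarrow> nat set \<Rightarrow> nat set \<Rightarrow> bool" where
  "j_connected_sets j E J J' \<longleftrightarrow>
     (\<exists>p. p \<noteq> [] \<and> set p \<subseteq> E \<and> J \<subseteq> hd p \<and> J' \<subseteq> last p \<and>
          successively (\<lambda>e e'. j \<le> card (e \<inter> e')) p)"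

definition j_connected :: "nat \<Rightarrow> nat \<Rightarrow> nat set set \<Rightarrow> bool" where
  "j_connected n j E \<longleftrightarrow>
     (\<forall>J\<in>sets_of_size n j. \<forall>J'\<in>sets_of_size n j. J \<noteq> J' \<longrightarrow> j_connected_sets j E J J')"

text \<open>
  For \<open>1 \<le> j < k \<le> n\<close> the complete hypergraph is \<open>j\<close>-connected and has no isolated \<open>j\<close>-set, so both
  minima are attained on every run of the full process.
\<close>

definition tau_C :: "nat \<Rightarrow> nat \<Rightarrow> nat set list \<Rightarrow> nat" where
  "tau_C n j es = (LEAST M. j_connected n j (edges_at es M))"

definition tau_I :: "nat \<Rightarrow> nat \<Rightarrow> nat set list \<Rightarrow> nat" where
  "tau_I n j es = (LEAST M. \<forall>J\<in>sets_of_size n j. \<not> isolated (edges_at es M) J)"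

end

theory Submission
  imports Defs "HOL-Combinatorics.Multiset_Permutations" "HOL-Real_Asymp.Real_Asymp"
begin

text \<open>
  Let \<open>T\<close> be the number of \<open>j\<close>-sets and \<open>q = k choose j \<ge> 3\<close>; a \<open>j\<close>-set is expected to be covered at
  around step \<open>j \<cdot> ln n \<cdot> T / q\<close>. Let \<open>M0\<close> be half and \<open>M1\<close> twice that number. With high probability
  \<open>M0 < \<tau>\<^sub>I \<le> M1\<close>, by the second and the first moment of the number of isolated \<open>j\<close>-sets.

  At step \<open>M0\<close> all edges already lie in one component. Otherwise the \<open>j\<close>-sets covered by some
  component form a set \<open>S\<close> with \<open>q \<le> s \<le> T / 2\<close>, where \<open>s = |S|\<close>, and \<open>S\<close> is covered by a connected
  set of at most \<open>s\<close> edges, while no \<open>k\<close>-set with \<open>j\<close>-subsets both in \<open>S\<close> and outside \<open>S\<close> is an edge.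
  There are about \<open>s\<close> times the degree of a \<open>j\<close>-set of these crossing \<open>k\<close>-sets if \<open>s\<close> is bounded, and a
  constant fraction of that for all \<open>s \<le> T / 2\<close>. A percolation weight bounds the number of
  connected sets of \<open>m\<close> edges, so that about \<open>n\<^sup>j (C ln n)\<^sup>m\<close> of them are expected to be present, and
  the crossing \<open>k\<close>-sets contribute a factor \<open>exp (- (j s / 2) ln n)\<close> for bounded \<open>s\<close> and
  \<open>exp (- c s ln n)\<close> in general. The product tends to \<open>0\<close> because \<open>s \<ge> 3\<close> and \<open>m \<le> s\<close>.

  Between the steps \<open>M0\<close> and \<open>M1\<close> no edge is added all of whose \<open>j\<close>-subsets are isolated, for the
  same reason. Hence there is a single component of edges throughout, and the hypergraph is
  \<open>j\<close>-connected as soon as no \<open>j\<close>-set is isolated.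
\<close>

section \<open>Connected subsets of a graph of bounded degree\<close>

text \<open>A cut condition saying that every element of \<open>C\<close> is reached from
  \<open>A\<close> along \<open>R\<close> inside \<open>C\<close>. For \<open>A = {r}\<close> and
  symmetric \<open>R\<close> it describes the connected sets containing \<open>r\<close>. In this
  form it passes at once from \<open>A\<close> to \<open>insert v A\<close>.\<close>

definition grown :: "('a \<Rightarrow> 'a \<Rightarrow> bool) \<Rightarrow> 'a set \<Rightarrow> 'a set \<Rightarrow> bool" where
  "grown R A C \<longleftrightarrow> A \<subseteq> C \<and> (\<forall>X. A \<subseteq> X \<and> X \<subset> C \<longrightarrow> (\<exists>u\<in>X. \<exists>v\<in>C - X. R u v))"

definition outer_boundary :: "('a \<Rightarrow> 'a \<Rightarrow> bool) \<Rightarrow> 'a set \<Rightarrow> 'a set \<Rightarrow> 'a set" where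
  "outer_boundary R V C = {v \<in> V - C. \<exists>u\<in>C. R u v}"

text \<open>
  The summand is the probability, in site percolation with density \<open>q\<close> conditioned on \<open>A\<close> being open
  and \<open>B\<close> being closed, that \<open>C\<close> is the open cluster of \<open>A\<close>. Revealing one further boundary vertex of
  \<open>A\<close> gives the induction step.
\<close>

lemma sum_grown_percolation_weight_le_1:
  fixes q :: real
  assumes V: "finite V" and q: "0 \<le> q" "q \<le> 1"
    and AB: "A \<subseteq> V" "B \<subseteq> V" "A \<inter> B = {}"
  shows "(\<Sum>C | C \<subseteq> V \<and> C \<inter> B = {} \<and> grown R A C.
            q ^ card (C - A) * (1 - q) ^ card (outer_boundary R V C - B)) \<le> 1"
  using AB
proof (induction "card (V - (A \<union> B))" arbitrary: A B rule: less_induct)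
  case less
  define W where "W A B C = q ^ card (C - A) * (1 - q) ^ card (outer_boundary R V C - B)" for A B C
  define F where "F A B = {C. C \<subseteq> V \<and> C \<inter> B = {} \<and> grown R A C}" for A B
  have finF: "finite (F A B)" for A B
    by (rule finite_subset[of _ "Pow V"]) (auto simp: F_def V)
  have W0: "0 \<le> W A B C" for A B C using q by (simp add: W_def)
  show ?case
  \<comment> \<open>If all boundary vertices of \<open>A\<close> are closed, the exploration has
    stopped and only \<open>C = A\<close> remains. Otherwise the sum is split by the state of one
    unrevealed boundary vertex.\<close>
  proof (cases "outer_boundary R V A \<subseteq> B")
    case True
    have "F A B \<subseteq> {A}"
    proof
      fix C assume C: "C \<in> F A B"
      have "C = A"
      proof (rule ccontr)
        assume "C \<noteq> A"
        then have "\<exists>u\<in>A. \<exists>v\<in>C - A. R u v" using C by (auto simp: F_def grown_def)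
        then show False using True C by (auto simp: F_def outer_boundary_def)
      qed
      then show "C \<in> {A}" by simp
    qed
    then have "sum (W A B) (F A B) \<le> sum (W A B) {A}"
      by (intro sum_mono2) (auto simp: W0)
    also have "\<dots> \<le> 1" using q by (simp add: W_def power_le_one)
    finally show ?thesis by (simp add: W_def F_def)
  next
    case False
    then obtain v where v: "v \<in> outer_boundary R V A" "v \<notin> B" by auto
    have vV: "v \<in> V" "v \<notin> A" using v by (auto simp: outer_boundary_def)
    have lt: "V - (insert v A \<union> B) \<subset> V - (A \<union> B)" "V - (A \<union> insert v B) \<subset> V - (A \<union> B)"
      using vV v by auto
    have IH1: "sum (W (insert v A) B) (F (insert v A) B) \<le> 1"
      unfolding W_def F_def
      by (rule less.hyps) (use less.prems vV v V psubset_card_mono[OF _ lt(1)] in auto)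
    have IH2: "sum (W A (insert v B)) (F A (insert v B)) \<le> 1"
      unfolding W_def F_def
      by (rule less.hyps) (use less.prems vV v V psubset_card_mono[OF _ lt(2)] in auto)
    have sub1: "{C \<in> F A B. v \<in> C} \<subseteq> F (insert v A) B"
      by (auto simp: F_def grown_def)
    have eq2: "{C \<in> F A B. v \<notin> C} = F A (insert v B)"
      by (auto simp: F_def grown_def)
    have w1: "W A B C = q * W (insert v A) B C" if "C \<in> F A B" "v \<in> C" for C
    proof -
      have "finite C" using that V by (auto simp: F_def intro: finite_subset)
      moreover have "C - A = insert v (C - insert v A)" using that vV by auto
      ultimately have "card (C - A) = Suc (card (C - insert v A))"
        by (metis DiffD2 card_insert_disjoint finite_Diff insertI1)
      then show ?thesis by (simp add: W_def)
    qed
    have w2: "W A B C = (1 - q) * W A (insert v B) C" if "C \<in> F A B" "v \<notin> C" for C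
    proof -
      \<comment> \<open>The neighbour of \<open>v\<close> in \<open>A\<close> lies in
        \<open>C\<close>, so \<open>v\<close> is a closed boundary vertex of \<open>C\<close> and
        accounts for one factor \<open>1 - q\<close>.\<close>
      have "v \<in> outer_boundary R V C"
        using v that by (auto simp: outer_boundary_def F_def grown_def)
      then have "outer_boundary R V C - B = insert v (outer_boundary R V C - insert v B)"
        using v by auto
      moreover have "finite (outer_boundary R V C)" using V by (auto simp: outer_boundary_def)
      ultimately have "card (outer_boundary R V C - B) = Suc (card (outer_boundary R V C - insert v B))"
        by (metis DiffD2 card_insert_disjoint finite_Diff insertI1)
      then show ?thesis by (simp add: W_def)
    qed
    have "sum (W A B) (F A B) = sum (W A B) {C \<in> F A B. v \<in> C} + sum (W A B) {C \<in> F A B. v \<notin> C}"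
      by (subst sum.union_disjoint[symmetric]) (auto simp: finF intro!: sum.cong)
    also have "sum (W A B) {C \<in> F A B. v \<in> C} = q * sum (W (insert v A) B) {C \<in> F A B. v \<in> C}"
      by (auto simp: sum_distrib_left w1 intro!: sum.cong)
    also have "sum (W A B) {C \<in> F A B. v \<notin> C} = (1 - q) * sum (W A (insert v B)) {C \<in> F A B. v \<notin> C}"
      by (auto simp: sum_distrib_left w2 intro!: sum.cong)
    also have "sum (W (insert v A) B) {C \<in> F A B. v \<in> C} \<le> sum (W (insert v A) B) (F (insert v A) B)"
      by (intro sum_mono2 sub1 finF) (auto simp: W0)
    also have "q * sum (W (insert v A) B) (F (insert v A) B) \<le> q * 1"
      by (intro mult_left_mono IH1 q)
    also have "(1 - q) * sum (W A (insert v B)) {C \<in> F A B. v \<notin> C} \<le> (1 - q) * 1"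
      unfolding eq2 using q by (intro mult_left_mono IH2) auto
    finally show ?thesis using q by (simp add: W_def F_def mult_left_mono)
  qed
qed

text \<open>Comparison with percolation of density \<open>2 * x\<close>. A set \<open>C\<close> has
  at most \<open>\<Delta> * card C\<close> boundary vertices, and
  \<open>(1 - 2 * x) ^ \<Delta> \<ge> 1/2\<close> by Bernoulli's inequality, so the extra factor 2
  per element of \<open>C\<close> pays for closing the boundary. The remaining \<open>2 * x\<close>
  is the factor of the root, which the percolation weight leaves out.\<close>

lemma sum_power_card_grown_le:
  fixes x :: real
  assumes V: "finite V" and r: "r \<in> V" and x: "0 \<le> x" "4 * real \<Delta> * x \<le> 1" and \<Delta>: "1 \<le> \<Delta>"
    and deg: "\<And>u. u \<in> V \<Longrightarrow> card {v \<in> V. R u v} \<le> \<Delta>"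
  shows "(\<Sum>C | C \<subseteq> V \<and> grown R {r} C. x ^ card C) \<le> 2 * x"
proof -
  define F where "F = {C. C \<subseteq> V \<and> grown R {r} C}"
  have q: "0 \<le> 2 * x" "2 * x \<le> 1"
  proof -
    have "1 * x \<le> real \<Delta> * x" using x \<Delta> by (intro mult_right_mono) auto
    then show "2 * x \<le> 1" using x by linarith
  qed (use x in auto)
  have "x ^ card C \<le> 2 * x * ((2*x) ^ card (C - {r}) * (1 - 2*x) ^ card (outer_boundary R V C))"
    if "C \<in> F" for C
  proof -
    have C: "C \<subseteq> V" "r \<in> C" "finite C"
      using that V finite_subset by (auto simp: F_def grown_def)
    have "outer_boundary R V C \<subseteq> (\<Union>u\<in>C. {v \<in> V. R u v})" by (auto simp: outer_boundary_def)
    then have "card (outer_boundary R V C) \<le> card (\<Union>u\<in>C. {v \<in> V. R u v})"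
      using V C by (intro card_mono) auto
    also have "\<dots> \<le> (\<Sum>u\<in>C. card {v \<in> V. R u v})" by (rule card_UN_le) (use C in auto)
    also have "\<dots> \<le> (\<Sum>u\<in>C. \<Delta>)" by (intro sum_mono deg) (use C in auto)
    finally have b: "card (outer_boundary R V C) \<le> \<Delta> * card C" by (simp add: mult.commute)
    have "1/2 \<le> 1 - real \<Delta> * (2 * x)" using x by simp
    also have "\<dots> \<le> (1 - 2 * x) ^ \<Delta>"
      using Bernoulli_inequality[of "- (2*x)" \<Delta>] q by simp
    finally have "x \<le> 2 * x * (1 - 2*x)^\<Delta>" using mult_left_mono[of "1/2" "(1 - 2*x)^\<Delta>" "2*x"] x by simp
    then have "x ^ card C \<le> (2 * x * (1 - 2*x)^\<Delta>) ^ card C" using x by (intro power_mono) auto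
    also have "\<dots> = (2*x) ^ card C * (1 - 2*x)^(\<Delta> * card C)"
      by (simp add: power_mult_distrib power_mult)
    also have "\<dots> \<le> (2*x) ^ card C * (1 - 2*x)^card (outer_boundary R V C)"
      using q b by (intro mult_left_mono power_decreasing) auto
    also have "(2*x) ^ card C = 2 * x * (2*x) ^ card (C - {r})" 
      using C by (metis card_Suc_Diff1 power_Suc)
    finally show ?thesis by (simp add: mult_ac)
  qed
  then have "(\<Sum>C\<in>F. x ^ card C)
     \<le> (\<Sum>C\<in>F. 2 * x * ((2*x) ^ card (C - {r}) * (1 - 2*x) ^ card (outer_boundary R V C)))"
    by (rule sum_mono)
  also have "\<dots> = 2 * x * (\<Sum>C\<in>F. (2*x) ^ card (C - {r}) * (1 - 2*x) ^ card (outer_boundary R V C))"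
    by (simp add: sum_distrib_left)
  also have "\<dots> \<le> 2 * x * 1"
    using sum_grown_percolation_weight_le_1[OF V q, of "{r}" "{}" R] r q(1)
    by (intro mult_left_mono) (auto simp: F_def)
  finally show ?thesis by (simp add: F_def)
qed

section \<open>Uniform subsets\<close>

lemma Suc_times_binomial_Suc_real:
  "real (Suc m) * real (n choose Suc m) = real (n choose m) * real (n - m)"
  using binomial_absorb_comp[of n m] binomial_absorption[of m n]
  by (metis mult.commute of_nat_mult)

text \<open>Bounds the probability that a uniform \<open>m\<close>-subset of \<open>N\<close> points
  misses \<open>b\<close> given ones. When elements are added one at a time, each misses them with
  conditional probability at most \<open>1 - b / N\<close>.\<close>

lemma binomial_diff_le_exp:
  fixes N b m :: nat
  assumes "m \<le> N"
  shows "real ((N - b) choose m) \<le> real (N choose m) * exp (- real b * real m / real N)"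
  using assms
proof (induction m)
  case 0 then show ?case by simp
next
  case (Suc m)
  note 1 = Suc_times_binomial_Suc_real[of m "N - b"]
  note 2 = Suc_times_binomial_Suc_real[of m N]
  have 3: "real (N - b - m) \<le> real (N - m) * exp (- real b / real N)"
  proof (cases "b + m \<le> N")
    case True
    have "real b * (real N - real m) \<le> real b * real N" by (intro mult_left_mono) auto
    then have "real (N - b - m) \<le> real (N - m) * (1 + (- real b / real N))"
      using True Suc.prems by (simp add: field_simps of_nat_diff)
    also have "\<dots> \<le> real (N - m) * exp (- real b / real N)"
      by (intro mult_left_mono exp_ge_add_one_self) auto
    finally show ?thesis .
  qed simp
  have "real (Suc m) * real ((N - b) choose Suc m)
      \<le> (real (N choose m) * exp (- real b * real m / real N)) * (real (N - m) * exp (- real b / real N))"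
    unfolding 1 using Suc by (intro mult_mono 3) auto
  also have "\<dots> = real (Suc m) * (real (N choose Suc m) * exp (- real b * real (Suc m) / real N))"
  proof -
    have "exp (- real b * real (Suc m) / real N) = exp (- real b * real m / real N) * exp (- real b / real N)"
      by (simp add: exp_add[symmetric] add_divide_distrib algebra_simps diff_divide_distrib)
    then show ?thesis
      by (simp only: mult.assoc[symmetric] 2) (simp only: mult.assoc mult.left_commute mult.commute)
  qed
  finally show ?case by (simp del: of_nat_Suc)
qed

text \<open>Bounds the probability that a uniform \<open>M\<close>-subset of \<open>N\<close> points
  contains \<open>a\<close> given ones: the conditional probabilities
  \<open>(M - a) / (N - a)\<close> are at most \<open>M / N\<close>.\<close>

lemma binomial_diff_both_le:
  fixes N M a :: nat
  assumes "a \<le> M" "M \<le> N"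
  shows "real ((N - a) choose (M - a)) \<le> real (N choose M) * (real M / real N) ^ a"
  using assms
proof (induction a)
  case (Suc a)
  have N: "N - a = Suc (N - Suc a)" "M - a = Suc (M - Suc a)" using Suc.prems by auto
  have "real (N - a) * real ((N - Suc a) choose (M - Suc a)) = real (M - a) * real ((N - a) choose (M - a))"
    unfolding N using Suc_times_binomial[of "M - Suc a" "N - Suc a"]
    by (metis of_nat_mult mult.commute)
  then have "real ((N - Suc a) choose (M - Suc a)) = real (M - a) / real (N - a) * real ((N - a) choose (M - a))"
    using Suc.prems by (simp add: field_simps)
  also have "\<dots> \<le> real M / real N * (real (N choose M) * (real M / real N) ^ a)"
  proof (intro mult_mono Suc.IH)
    have "real a * real M \<le> real a * real N" using Suc.prems by (intro mult_left_mono) auto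
    then show "real (M - a) / real (N - a) \<le> real M / real N"
      using Suc.prems by (simp add: field_simps of_nat_diff)
  qed (use Suc.prems in auto)
  finally show ?case by (simp add: field_simps)
qed simp

section \<open>Uniformly random lists of distinct elements\<close>

definition distinct_lists :: "'a set \<Rightarrow> nat \<Rightarrow> 'a list set" where
  "distinct_lists V M = {es. length es = M \<and> distinct es \<and> set es \<subseteq> V}"

lemma finite_distinct_lists [simp]: "finite V \<Longrightarrow> finite (distinct_lists V M)"
  unfolding distinct_lists_def
  by (rule finite_subset[OF _ finite_lists_length_eq[of V M]]) auto

lemma distinct_lists_nonempty: "finite V \<Longrightarrow> M \<le> card V \<Longrightarrow> distinct_lists V M \<noteq> {}"
proof -
  assume "finite V" "M \<le> card V"
  then obtain X where "X \<subseteq> V" "card X = M" "finite X" by (meson obtain_subset_with_card_n)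
  then show ?thesis using finite_distinct_list[of X]
    by (auto simp: distinct_lists_def distinct_card)
qed

lemma distinct_lists_Suc:
  "distinct_lists V (Suc M) = (\<Union>es\<in>distinct_lists V M. (\<lambda>e. es @ [e]) ` (V - set es))"
proof (intro set_eqI iffI)
  fix fs assume "fs \<in> distinct_lists V (Suc M)"
  then have fs: "length fs = Suc M" "distinct fs" "set fs \<subseteq> V" by (auto simp: distinct_lists_def)
  then obtain es e where "fs = es @ [e]" by (metis length_Suc_conv_rev)
  with fs show "fs \<in> (\<Union>es\<in>distinct_lists V M. (\<lambda>e. es @ [e]) ` (V - set es))"
    by (auto simp: distinct_lists_def)
qed (auto simp: distinct_lists_def)

lemma card_distinct_lists_Suc:
  assumes "finite V"
  shows "card (distinct_lists V (Suc M)) = card (distinct_lists V M) * (card V - M)"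
proof -
  have "card (distinct_lists V (Suc M))
      = (\<Sum>es\<in>distinct_lists V M. card ((\<lambda>e. es @ [e]) ` (V - set es)))"
    unfolding distinct_lists_Suc using assms by (intro card_UN_disjoint) auto
  also have "\<dots> = (\<Sum>es\<in>distinct_lists V M. card V - M)"
  proof (intro sum.cong refl)
    fix es assume "es \<in> distinct_lists V M"
    then have "set es \<subseteq> V" "card (set es) = M" by (auto simp: distinct_lists_def distinct_card)
    then show "card ((\<lambda>e. es @ [e]) ` (V - set es)) = card V - M"
      using assms by (subst card_image) (auto simp: inj_on_def card_Diff_subset)
  qed
  finally show ?thesis by simp
qed

text \<open>Every \<open>M\<close>-subset has the same number \<open>fact M\<close> of orderings, so
  forgetting the order of a uniform list leaves a uniform subset.\<close>

lemma map_set_pmf_of_distinct_lists: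
  assumes V: "finite V" and M: "M \<le> card V"
  shows "map_pmf set (pmf_of_set (distinct_lists V M)) = pmf_of_set {X. X \<subseteq> V \<and> card X = M}"
proof -
  let ?S = "{X. X \<subseteq> V \<and> card X = M}"
  have finS: "finite ?S" using V by (auto intro: finite_subset[of _ "Pow V"])
  have fin: "finite X" if "X \<in> ?S" for X using that V finite_subset by auto
  have ne: "?S \<noteq> {}" using obtain_subset_with_card_n[OF M] by auto
  have U: "distinct_lists V M = (\<Union>X\<in>?S. permutations_of_set X)"
    by (auto simp: distinct_lists_def permutations_of_set_def distinct_card)
  have "pmf_of_set (distinct_lists V M) = bind_pmf (pmf_of_set ?S) (\<lambda>X. pmf_of_set (permutations_of_set X))"
    unfolding U
  proof (rule pmf_of_set_UN)
    show "finite (\<Union>X\<in>?S. permutations_of_set X)" using finS by auto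
    show "?S \<noteq> {}" by (rule ne)
    show "permutations_of_set X \<noteq> {}" if "X \<in> ?S" for X
      using fin[OF that] by simp
    show "card (permutations_of_set X) = fact M" if "X \<in> ?S" for X
      using that fin[OF that] by simp
    show "disjoint_family_on permutations_of_set ?S"
      by (auto simp: disjoint_family_on_def permutations_of_set_def)
  qed
  also have "map_pmf set \<dots> = bind_pmf (pmf_of_set ?S) (\<lambda>X. map_pmf set (pmf_of_set (permutations_of_set X)))"
    by (simp add: map_bind_pmf)
  also have "\<dots> = bind_pmf (pmf_of_set ?S) return_pmf"
  proof (intro bind_pmf_cong refl)
    fix X assume "X \<in> set_pmf (pmf_of_set ?S)"
    then have X: "X \<in> ?S" using finS ne by simp
    have "map_pmf set (pmf_of_set (permutations_of_set X)) = map_pmf (\<lambda>_. X) (pmf_of_set (permutations_of_set X))"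
      by (intro map_pmf_cong refl) (use fin[OF X] in \<open>auto simp: permutations_of_setD\<close>)
    then show "map_pmf set (pmf_of_set (permutations_of_set X)) = return_pmf X" by simp
  qed
  finally show ?thesis by (simp add: bind_return_pmf')
qed

lemma card_subsets_between:
  assumes V: "finite V" and A: "A \<subseteq> V" and B: "B \<subseteq> V" and AB: "A \<inter> B = {}" and aM: "card A \<le> M"
  shows "card {X. X \<subseteq> V \<and> card X = M \<and> A \<subseteq> X \<and> B \<inter> X = {}} = (card V - card A - card B) choose (M - card A)"
proof -
  have fin: "finite A" "finite B" using V A B finite_subset by auto
  have "bij_betw (\<lambda>Y. A \<union> Y) {Y. Y \<subseteq> V - A - B \<and> card Y = M - card A} {X. X \<subseteq> V \<and> card X = M \<and> A \<subseteq> X \<and> B \<inter> X = {}}"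
  proof (rule bij_betw_byWitness[where f' = "\<lambda>X. X - A"])
    show "(\<union>) A ` {Y. Y \<subseteq> V - A - B \<and> card Y = M - card A} \<subseteq> {X. X \<subseteq> V \<and> card X = M \<and> A \<subseteq> X \<and> B \<inter> X = {}}"
    proof clarify
      fix Y assume Y: "Y \<subseteq> V - A - B" "card Y = M - card A"
      then have "finite Y" using V by (meson finite_Diff finite_subset)
      then have "card (A \<union> Y) = M" using Y aM fin by (subst card_Un_disjoint) auto
      then show "A \<union> Y \<subseteq> V \<and> card (A \<union> Y) = M \<and> A \<subseteq> A \<union> Y \<and> B \<inter> (A \<union> Y) = {}"
        using Y A AB by auto
    qed
    show "(\<lambda>X. X - A) ` {X. X \<subseteq> V \<and> card X = M \<and> A \<subseteq> X \<and> B \<inter> X = {}} \<subseteq> {Y. Y \<subseteq> V - A - B \<and> card Y = M - card A}"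
      using fin by (auto simp: card_Diff_subset)
  qed auto
  then have "card {X. X \<subseteq> V \<and> card X = M \<and> A \<subseteq> X \<and> B \<inter> X = {}} = card {Y. Y \<subseteq> V - A - B \<and> card Y = M - card A}"
    by (rule bij_betw_same_card[symmetric])
  also have "\<dots> = card (V - A - B) choose (M - card A)"
    by (rule n_subsets) (use V in auto)
  also have "card (V - A - B) = card V - card A - card B"
    using A B AB fin by (subst card_Diff_subset; (subst card_Diff_subset)?) auto
  finally show ?thesis .
qed

lemma prob_distinct_lists_between:
  assumes V: "finite V" and A: "A \<subseteq> V" and B: "B \<subseteq> V" and AB: "A \<inter> B = {}"
    and aM: "card A \<le> M" and M: "M \<le> card V"
  shows "measure_pmf.prob (pmf_of_set (distinct_lists V M)) {es. A \<subseteq> set es \<and> B \<inter> set es = {}}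
    = real ((card V - card A - card B) choose (M - card A)) / real (card V choose M)"
proof -
  let ?S = "{X. X \<subseteq> V \<and> card X = M}"
  have finS: "finite ?S" using V by (auto intro: finite_subset[of _ "Pow V"])
  have ne: "?S \<noteq> {}" using obtain_subset_with_card_n[OF M] by auto
  have "measure_pmf.prob (pmf_of_set (distinct_lists V M)) {es. A \<subseteq> set es \<and> B \<inter> set es = {}}
    = measure_pmf.prob (map_pmf set (pmf_of_set (distinct_lists V M))) {X. A \<subseteq> X \<and> B \<inter> X = {}}"
    by (simp add: vimage_def)
  also have "\<dots> = real (card (?S \<inter> {X. A \<subseteq> X \<and> B \<inter> X = {}})) / real (card ?S)"
    unfolding map_set_pmf_of_distinct_lists[OF V M] using ne finS by (rule measure_pmf_of_set)
  also have "?S \<inter> {X. A \<subseteq> X \<and> B \<inter> X = {}} = {X. X \<subseteq> V \<and> card X = M \<and> A \<subseteq> X \<and> B \<inter> X = {}}" by auto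
  finally show ?thesis using card_subsets_between[OF V A B AB aM] n_subsets[OF V, of M] by simp
qed

text \<open>The presence of \<open>A\<close> costs a factor \<open>M / card V\<close> per element.
  The other \<open>M - card A\<close> entries then have to avoid \<open>B\<close>, which gives the
  exponential.\<close>

lemma prob_distinct_lists_between_le:
  assumes V: "finite V" and A: "A \<subseteq> V" and B: "B \<subseteq> V" and M: "M \<le> card V" and AB: "A \<inter> B = {}"
    and aM: "card A \<le> M"
  shows "measure_pmf.prob (pmf_of_set (distinct_lists V M)) {es. A \<subseteq> set es \<and> B \<inter> set es = {}}
    \<le> (real M / real (card V)) ^ card A * exp (- (real (card B) * real (M - card A) / real (card V)))"
proof -
  let ?N = "card V" and ?a = "card A" and ?b = "card B"
  have "real ((?N - ?a - ?b) choose (M - ?a)) \<le> real ((?N - ?a) choose (M - ?a)) * exp (- real ?b * real (M - ?a) / real (?N - ?a))"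
    by (rule binomial_diff_le_exp) (use M in auto)
  also have "\<dots> \<le> (real (?N choose M) * (real M / real ?N) ^ ?a) * exp (- (real ?b * real (M - ?a) / real ?N))"
  proof (intro mult_mono binomial_diff_both_le aM M)
    have "real ?b * real (M - ?a) / real ?N \<le> real ?b * real (M - ?a) / real (?N - ?a)"
    \<comment> \<open>If \<open>A\<close> exhausts \<open>V\<close>, a quotient has denominator 0,
      but then \<open>M - card A = 0\<close> and both sides vanish.\<close>
    proof (cases "?N - ?a = 0")
      case False
      then show ?thesis by (intro divide_left_mono) auto
    next
      case True
      then have "M - ?a = 0" using M by simp
      then show ?thesis by simp
    qed
    then show "exp (- real ?b * real (M - ?a) / real (?N - ?a)) \<le> exp (- (real ?b * real (M - ?a) / real ?N))"
      by simp
  qed auto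
  finally have "real ((?N - ?a - ?b) choose (M - ?a)) / real (?N choose M)
     \<le> (real M / real ?N) ^ ?a * exp (- (real ?b * real (M - ?a) / real ?N))"
    using M by (simp add: field_simps)
  then show ?thesis using prob_distinct_lists_between[OF V A B AB aM M] by simp
qed

text \<open>For a prescribed last entry, deleting it is an injection into the lists of length
  \<open>M\<close> that avoid \<open>B\<close>, while there are \<open>card V - M\<close> times as
  many lists of length \<open>Suc M\<close> as of length \<open>M\<close>.\<close>

lemma prob_distinct_lists_last_le:
  assumes V: "finite V" and B: "B \<subseteq> V" and M: "M < card V"
  shows "measure_pmf.prob (pmf_of_set (distinct_lists V (Suc M))) {es. last es = e \<and> B \<inter> set (butlast es) = {}}
    \<le> exp (- (real (card B) * real M / real (card V))) / real (card V - M)"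
proof -
  let ?P = "{es. last es = e \<and> B \<inter> set (butlast es) = {}}"
  have inj: "inj_on butlast (distinct_lists V (Suc M) \<inter> ?P)"
  proof (rule inj_onI)
    fix x y assume "x \<in> distinct_lists V (Suc M) \<inter> ?P" "y \<in> distinct_lists V (Suc M) \<inter> ?P" "butlast x = butlast y"
    then show "x = y" by (auto simp: distinct_lists_Suc)
  qed
  have "butlast ` (distinct_lists V (Suc M) \<inter> ?P) \<subseteq> distinct_lists V M \<inter> {es. {} \<subseteq> set es \<and> B \<inter> set es = {}}"
    by (auto simp: distinct_lists_Suc)
  then have c: "card (distinct_lists V (Suc M) \<inter> ?P) \<le> card (distinct_lists V M \<inter> {es. {} \<subseteq> set es \<and> B \<inter> set es = {}})"
    by (metis (no_types, lifting) V card_image card_mono finite_Int finite_distinct_lists inj)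
  have ne: "distinct_lists V (Suc M) \<noteq> {}" "distinct_lists V M \<noteq> {}"
    using M distinct_lists_nonempty[OF V, of "Suc M"] distinct_lists_nonempty[OF V, of M] by auto
  have "measure_pmf.prob (pmf_of_set (distinct_lists V (Suc M))) ?P
      = real (card (distinct_lists V (Suc M) \<inter> ?P)) / real (card (distinct_lists V (Suc M)))"
    by (rule measure_pmf_of_set) (use V ne in auto)
  also have "\<dots> \<le> real (card (distinct_lists V M \<inter> {es. {} \<subseteq> set es \<and> B \<inter> set es = {}})) / real (card (distinct_lists V (Suc M)))"
    using c by (intro divide_right_mono) auto
  also have "\<dots> = measure_pmf.prob (pmf_of_set (distinct_lists V M)) {es. {} \<subseteq> set es \<and> B \<inter> set es = {}} / real (card V - M)"
    using V ne by (simp add: measure_pmf_of_set card_distinct_lists_Suc)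
  also have "\<dots> \<le> (real M / real (card V)) ^ card {} * exp (- (real (card B) * real (M - card {}) / real (card V))) / real (card V - M)"
    using prob_distinct_lists_between_le[OF V _ B, of "{}" M] M by (intro divide_right_mono) auto
  finally show ?thesis by simp
qed

section \<open>The law of the process\<close>

lemma finite_sets_of_size [simp]: "finite (sets_of_size n i)"
  unfolding sets_of_size_def by (rule finite_subset[of _ "Pow {1..n}"]) auto

lemma finite_mem_sets_of_size: "e \<in> sets_of_size n i \<Longrightarrow> finite e"
  unfolding sets_of_size_def using finite_subset by fastforce

lemma card_sets_of_size [simp]: "card (sets_of_size n i) = n choose i"
  unfolding sets_of_size_def using n_subsets[of "{1..n}" i] by simp

lemma card_sets_of_size_superset:
  assumes "U \<subseteq> {1..n}" "card U \<le> k"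
  shows "card {e \<in> sets_of_size n k. U \<subseteq> e} = (n - card U) choose (k - card U)"
  using card_subsets_between[of "{1..n}" U "{}" k] assms by (simp add: sets_of_size_def conj_ac)

text \<open>Some \<open>x\<close> lies in \<open>J'\<close> but not in \<open>J\<close>, so every
  common superset contains the set \<open>insert x J\<close> of size \<open>j + 1\<close>.\<close>

lemma card_superset_both_le:
  assumes "J \<in> sets_of_size n j" "J' \<in> sets_of_size n j" "J \<noteq> J'" "j < k"
  shows "card ({e \<in> sets_of_size n k. J \<subseteq> e} \<inter> {e \<in> sets_of_size n k. J' \<subseteq> e})
    \<le> (n - Suc j) choose (k - Suc j)"
proof -
  have J: "card J = j" "card J' = j" "J \<subseteq> {1..n}" "J' \<subseteq> {1..n}"
    using assms by (auto simp: sets_of_size_def)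
  then have fin: "finite J" "finite J'" using finite_subset by auto
  obtain x where x: "x \<in> J'" "x \<notin> J" using J fin assms(3) by (metis card_subset_eq subsetI)
  have "{e \<in> sets_of_size n k. J \<subseteq> e} \<inter> {e \<in> sets_of_size n k. J' \<subseteq> e}
      \<subseteq> {e \<in> sets_of_size n k. insert x J \<subseteq> e}" using x by auto
  then have "card ({e \<in> sets_of_size n k. J \<subseteq> e} \<inter> {e \<in> sets_of_size n k. J' \<subseteq> e})
      \<le> card {e \<in> sets_of_size n k. insert x J \<subseteq> e}" by (intro card_mono) auto
  also have "\<dots> = (n - Suc j) choose (k - Suc j)"
    using card_sets_of_size_superset[of "insert x J" n k] J x fin assms(4) by auto
  finally show ?thesis .
qed

text \<open>Every list of \<open>M\<close> distinct edges has the same number of one-edge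
  extensions, so successive uniform choices produce a uniform list.\<close>

lemma first_edges_eq_pmf_of_set:
  assumes "M \<le> n choose k"
  shows "first_edges k n M = pmf_of_set (distinct_lists (sets_of_size n k) M)"
  using assms
proof (induction M)
  case 0
  have "distinct_lists (sets_of_size n k) 0 = {[]}" by (auto simp: distinct_lists_def)
  then show ?case by (simp add: pmf_of_set_singleton)
next
  case (Suc M)
  let ?K = "sets_of_size n k"
  have ne: "distinct_lists ?K M \<noteq> {}" by (rule distinct_lists_nonempty) (use Suc.prems in auto)
  have card_rest: "card (?K - set es) = (n choose k) - M" if "es \<in> distinct_lists ?K M" for es
    using that by (auto simp: distinct_lists_def card_Diff_subset distinct_card)
  have rest_ne: "?K - set es \<noteq> {}" if "es \<in> distinct_lists ?K M" for es
    using card_rest[OF that] Suc.prems by (metis Suc_le_lessD card.empty less_numeral_extra(3) zero_less_diff)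
  have inj: "inj_on (\<lambda>e. es @ [e]) X" for es :: "nat set list" and X by (auto simp: inj_on_def)
  have "first_edges k n (Suc M) = bind_pmf (pmf_of_set (distinct_lists ?K M))
       (\<lambda>es. map_pmf (\<lambda>e. es @ [e]) (pmf_of_set (?K - set es)))"
    using Suc by simp
  also have "\<dots> = bind_pmf (pmf_of_set (distinct_lists ?K M))
       (\<lambda>es. pmf_of_set ((\<lambda>e. es @ [e]) ` (?K - set es)))"
    by (intro bind_pmf_cong refl map_pmf_of_set_inj inj) (use ne rest_ne in auto)
  also have "\<dots> = pmf_of_set (distinct_lists ?K (Suc M))"
    unfolding distinct_lists_Suc
  proof (rule pmf_of_set_UN[symmetric])
    show "card ((\<lambda>e. es @ [e]) ` (?K - set es)) = (n choose k) - M" if "es \<in> distinct_lists ?K M" for es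
      using card_rest[OF that] by (simp add: card_image inj)
    show "disjoint_family_on (\<lambda>es. (\<lambda>e. es @ [e]) ` (?K - set es)) (distinct_lists ?K M)"
      by (auto simp: disjoint_family_on_def)
  qed (use ne rest_ne in auto)
  finally show ?case .
qed

lemma set_pmf_first_edges:
  assumes "M \<le> n choose k"
  shows "set_pmf (first_edges k n M) = distinct_lists (sets_of_size n k) M"
  unfolding first_edges_eq_pmf_of_set[OF assms] using assms
  by (intro set_pmf_of_set distinct_lists_nonempty) auto

lemma map_take_first_edges:
  assumes "M \<le> M'" "M' \<le> n choose k"
  shows "map_pmf (take M) (first_edges k n M') = first_edges k n M"
  using assms
proof (induction M' rule: dec_induct)
  case base
  have "map_pmf (take M) (first_edges k n M) = map_pmf id (first_edges k n M)"
    by (intro map_pmf_cong refl) (use base set_pmf_first_edges in \<open>auto simp: distinct_lists_def\<close>)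
  then show ?case by simp
next
  case (step M')
  have len: "length es = M'" if "es \<in> set_pmf (first_edges k n M')" for es
    using that step set_pmf_first_edges[of M' n k] by (auto simp: distinct_lists_def)
  have "map_pmf (take M) (first_edges k n (Suc M')) =
     bind_pmf (first_edges k n M') (\<lambda>es. map_pmf (\<lambda>e. take M (es @ [e])) (pmf_of_set (sets_of_size n k - set es)))"
    by (simp add: map_bind_pmf map_pmf_comp)
  also have "\<dots> = bind_pmf (first_edges k n M') (\<lambda>es. return_pmf (take M es))"
    by (intro bind_pmf_cong refl) (use step len in auto)
  also have "\<dots> = first_edges k n M"
    using step by (simp add: map_pmf_def)
  finally show ?case .
qed

text \<open>Reduces an event about the first \<open>M\<close> edges of the full run to a count of
  lists of length \<open>M\<close>.\<close>

lemma prob_hypergraph_process_take: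
  assumes "M \<le> n choose k"
  shows "measure_pmf.prob (hypergraph_process k n) {es. Q (take M es)}
    = measure_pmf.prob (pmf_of_set (distinct_lists (sets_of_size n k) M)) {es. Q es}"
proof -
  have "measure_pmf.prob (map_pmf (take M) (first_edges k n (n choose k))) {es. Q es}
     = measure_pmf.prob (first_edges k n M) {es. Q es}"
    using map_take_first_edges[OF assms order_refl] by simp
  then show ?thesis
    by (simp add: hypergraph_process_def vimage_def first_edges_eq_pmf_of_set[OF assms])
qed

section \<open>Isoperimetry\<close>

text \<open>If \<open>S\<close> consists of the \<open>j\<close>-sets covered by one component, none
  of these \<open>k\<close>-sets can be an edge: such an edge would belong to the component through
  its \<open>j\<close>-subset in \<open>S\<close>, and then all its \<open>j\<close>-subsets would
  lie in \<open>S\<close>.\<close>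

definition crossing :: "nat \<Rightarrow> nat \<Rightarrow> nat \<Rightarrow> nat set set \<Rightarrow> nat set set" where
  "crossing n k j S =
     {e \<in> sets_of_size n k. (\<exists>J\<in>S. J \<subseteq> e) \<and> (\<exists>J. J \<subseteq> e \<and> card J = j \<and> J \<notin> S)}"

lemma exists_permutes_image:
  assumes V: "finite V" and "X \<subseteq> V" "Y \<subseteq> V" "card X = card Y"
  shows "\<exists>p. p permutes V \<and> p ` X = Y"
proof -
  have fin: "finite X" "finite Y" using assms finite_subset by auto
  obtain f where f: "bij_betw f X Y" using finite_same_card_bij[OF fin] assms by auto
  have "card (V - X) = card (V - Y)" using assms fin by (simp add: card_Diff_subset)
  then obtain g where g: "bij_betw g (V - X) (V - Y)" using finite_same_card_bij[of "V - X" "V - Y"] V by auto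
  define p where "p v = (if v \<in> X then f v else if v \<in> V then g v else v)" for v
  have 1: "bij_betw p X Y" using f by (subst bij_betw_cong[of _ _ f]) (auto simp: p_def)
  have 2: "bij_betw p (V - X) (V - Y)" using g by (subst bij_betw_cong[of _ _ g]) (auto simp: p_def)
  have "bij_betw p (X \<union> (V - X)) (Y \<union> (V - Y))"
    by (rule bij_betw_combine[OF 1 2]) auto
  then have "bij_betw p V V" using assms by (simp add: Un_absorb1)
  then have "p permutes V" by (rule bij_imp_permutes) (use assms in \<open>auto simp: p_def\<close>)
  moreover have "p ` X = Y" using 1 by (simp add: bij_betw_def)
  ultimately show ?thesis by blast
qed

text \<open>The image of \<open>A\<close> under a random permutation is uniform among the sets of
  its size: composing with a permutation that takes \<open>X\<close> to \<open>Y\<close> injects the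
  fibre over \<open>X\<close> into the fibre over \<open>Y\<close>.\<close>

lemma card_permutes_image_in:
  assumes V: "finite V" and A: "A \<subseteq> V" and F: "\<And>X. X \<in> F \<Longrightarrow> X \<subseteq> V \<and> card X = card A"
  shows "card {p. p permutes V \<and> p ` A \<in> F} * (card V choose card A) = card {p. p permutes V} * card F"
proof -
  let ?P = "{X. X \<subseteq> V \<and> card X = card A}"
  define c where "c X = card {p. p permutes V \<and> p ` A = X}" for X
  have finG: "finite {p. p permutes V}" using V by (rule finite_permutations)
  have le: "c X \<le> c Y" if XY: "X \<in> ?P" "Y \<in> ?P" for X Y
  proof -
    obtain s where s: "s permutes V" "s ` X = Y" using exists_permutes_image[OF V, of X Y] XY by auto
    have "inj s" using s by (simp add: permutes_inj)
    then have "inj_on (\<lambda>p. s \<circ> p) {p. p permutes V \<and> p ` A = X}"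
      by (auto simp: inj_on_def fun_eq_iff inj_def)
    moreover have "(\<lambda>p. s \<circ> p) ` {p. p permutes V \<and> p ` A = X} \<subseteq> {p. p permutes V \<and> p ` A = Y}"
      using s by (auto simp: image_comp[symmetric] intro: permutes_compose)
    moreover have "finite {p. p permutes V \<and> p ` A = Y}" using finG by auto
    ultimately show ?thesis unfolding c_def by (metis (no_types, lifting) card_inj_on_le)
  qed
  have eq: "c X = c A" if "X \<in> ?P" for X using le[of X A] le[of A X] that A by auto
  have count: "card {p. p permutes V \<and> p ` A \<in> F'} = card F' * c A" if "F' \<subseteq> ?P" for F'
  proof -
    have finF: "finite F'" using that V by (auto intro: finite_subset[of _ "Pow V"])
    have "{p. p permutes V \<and> p ` A \<in> F'} = (\<Union>X\<in>F'. {p. p permutes V \<and> p ` A = X})" by auto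
    then have "card {p. p permutes V \<and> p ` A \<in> F'} = (\<Sum>X\<in>F'. c X)"
      unfolding c_def using finG finF by (simp only:) (rule card_UN_disjoint, auto)
    also have "\<dots> = (\<Sum>X\<in>F'. c A)" using that eq by (intro sum.cong) auto
    finally show ?thesis by simp
  qed
  have "{p. p permutes V \<and> p ` A \<in> ?P} = {p. p permutes V}"
    using A by (auto simp: permutes_in_image card_image permutes_inj_on)
  then have "card {p. p permutes V} = card ?P * c A" using count[of ?P] by simp
  moreover have "card {p. p permutes V \<and> p ` A \<in> F} = card F * c A" using count[of F] F by auto
  moreover have "card ?P = card V choose card A" by (rule n_subsets[OF V])
  ultimately show ?thesis by simp
qed

text \<open>
  Average over the images of a fixed pair of \<open>j\<close>-sets under all permutations of the vertices.
  A pair is joined by a path of at most \<open>j\<close> one-element exchanges, and each exchange that leaves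
  \<open>S\<close> happens inside a crossing \<open>k\<close>-set.
\<close>

lemma crossing_ge_isoperimetric:
  assumes j: "j < k" and kn: "k \<le> n" and S: "S \<subseteq> sets_of_size n j" and s: "2 * card S \<le> n choose j"
  shows "real (card S) * real (n choose k) \<le> 2 * real j * real (n choose j) * real (card (crossing n k j S))"
proof -
  let ?V = "{1..n}" and ?T = "n choose j" and ?N = "n choose k"
  define G where "G = {p. p permutes ?V}"
  have finG: "finite G" unfolding G_def by (rule finite_permutations) simp
  have G0: "card G > 0" using finG permutes_id[of ?V] unfolding card_gt_0_iff G_def by blast
  \<comment> \<open>By \<open>cX\<close>, this is the number of permutations that take a given
    \<open>k\<close>-set to a crossing one; it is the same for all \<open>k\<close>-sets.\<close>
  define X where "X = real (card G) * real (card (crossing n k j S)) / real ?N"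
  have N0: "?N > 0" using kn by simp
  have T0: "?T > 0" using kn j by simp
  have cX: "real (card {p\<in>G. p ` K \<in> crossing n k j S}) = X" if "K \<in> sets_of_size n k" for K
  proof -
    have "card {p. p permutes ?V \<and> p ` K \<in> crossing n k j S} * (card ?V choose card K)
      = card {p. p permutes ?V} * card (crossing n k j S)"
      by (rule card_permutes_image_in) (use that in \<open>auto simp: sets_of_size_def crossing_def\<close>)
    moreover have "card K = k" using that by (simp add: sets_of_size_def)
    ultimately have "card {p\<in>G. p ` K \<in> crossing n k j S} * ?N = card G * card (crossing n k j S)"
      by (simp add: G_def)
    then show ?thesis unfolding X_def using N0 by (simp add: field_simps flip: of_nat_mult)
  qed
  define m where "m A B = card {p\<in>G. p ` A \<in> S \<and> p ` B \<notin> S}" for A B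
  have finm: "finite {p\<in>G. Q p}" for Q using finG by auto
  \<comment> \<open>The image of \<open>B\<close> is either outside \<open>S\<close> or inside it,
    so one of the two legs already leaves \<open>S\<close>.\<close>
  have tri: "m A C \<le> m A B + m B C" for A B C
  proof -
    have "m A C \<le> card ({p\<in>G. p ` A \<in> S \<and> p ` B \<notin> S} \<union> {p\<in>G. p ` B \<in> S \<and> p ` C \<notin> S})"
      unfolding m_def by (intro card_mono) (use finG in auto)
    also have "\<dots> \<le> m A B + m B C" unfolding m_def by (rule card_Un_le)
    finally show ?thesis .
  qed
  have step: "real (m A B) \<le> X" if AB: "A \<in> sets_of_size n j" "B \<in> sets_of_size n j" "card (A \<union> B) \<le> k" for A B
  proof -
    \<comment> \<open>Whenever the image of \<open>A\<close> is in \<open>S\<close> and that of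
      \<open>B\<close> is not, the image of \<open>K\<close> has \<open>j\<close>-subsets of both
      kinds and is crossing.\<close>
    obtain K where K: "A \<union> B \<subseteq> K" "K \<subseteq> ?V" "card K = k"
      using exists_subset_between[of "A \<union> B" k ?V] AB kn by (auto simp: sets_of_size_def)
    have KK: "K \<in> sets_of_size n k" using K by (auto simp: sets_of_size_def)
    have "m A B \<le> card {p\<in>G. p ` K \<in> crossing n k j S}"
      unfolding m_def
    proof (intro card_mono subsetI)
      fix p assume p: "p \<in> {p\<in>G. p ` A \<in> S \<and> p ` B \<notin> S}"
      then have pp: "p permutes ?V" by (simp add: G_def)
      have "p ` K \<in> sets_of_size n k" using K pp
        by (auto simp: sets_of_size_def card_image permutes_inj_on permutes_in_image dest: subsetD)
          (metis atLeastAtMost_iff permutes_in_image subsetD)+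
      moreover have "card (p ` B) = j" using pp AB by (simp add: card_image permutes_inj_on sets_of_size_def)
      moreover have "p ` A \<subseteq> p ` K" "p ` B \<subseteq> p ` K" using K by auto
      ultimately show "p \<in> {p\<in>G. p ` K \<in> crossing n k j S}" using p unfolding crossing_def by blast
    qed (use finG in auto)
    then show ?thesis using cX[OF KK] by linarith
  qed
  have X0: "0 \<le> X" by (simp add: X_def)
  have path: "real (m A B) \<le> real (card (A - B)) * X"
    if "A \<in> sets_of_size n j" "B \<in> sets_of_size n j" for A B
    using that
  proof (induction "card (A - B)" arbitrary: A)
    case 0
    then have "finite A" "finite B" "card A = card B" by (auto simp: sets_of_size_def intro: finite_subset)
    with 0 have "A = B" by (metis card_0_eq card_subset_eq Diff_eq_empty_iff finite_Diff)
    then show ?case using X0 by (simp add: m_def)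
  next
    case (Suc i)
    then have fin: "finite A" "finite B" and c: "card A = j" "card B = j" and sub: "A \<subseteq> ?V" "B \<subseteq> ?V"
      by (auto simp: sets_of_size_def intro: finite_subset)
    obtain a where a: "a \<in> A" "a \<notin> B" using Suc.hyps(2) by (metis Diff_iff card.empty ex_in_conv nat.distinct(1))
    have "card (B - A) = Suc i"
      using Suc.hyps(2) c fin by (metis Int_commute card_Diff_subset_Int finite_Int)
    then obtain b where b: "b \<in> B" "b \<notin> A" by (metis Diff_iff card.empty ex_in_conv nat.distinct(1))
    define A' where "A' = insert b (A - {a})"
    have A': "A' \<in> sets_of_size n j" using a b fin c sub by (auto simp: A'_def sets_of_size_def card_Diff_singleton) (metis Suc_pred card_gt_0_iff empty_iff)
    have "A' - B = (A - B) - {a}" using a b by (auto simp: A'_def)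
    then have i: "i = card (A' - B)" using Suc.hyps(2) a fin by simp
    \<comment> \<open>A single exchange spans only \<open>j + 1\<close> vertices, which fit into a
      \<open>k\<close>-set because \<open>j < k\<close>.\<close>
    have "A \<union> A' = insert b A" using a by (auto simp: A'_def)
    then have "card (A \<union> A') \<le> k" using b fin c j by simp
    then have 1: "real (m A A') \<le> X" using step Suc.prems A' by blast
    have 2: "real (m A' B) \<le> real i * X" using Suc.hyps(1)[OF i A' Suc.prems(2)] i by simp
    have "real (m A B) \<le> real (m A A') + real (m A' B)" using tri[of A B A'] by linarith
    also have "\<dots> \<le> real (Suc i) * X" using 1 2 by (simp add: algebra_simps)
    finally show ?case using Suc.hyps(2) by simp
  qed
  obtain A where A: "A \<subseteq> ?V" "card A = j" using obtain_subset_with_card_n[of j ?V] j kn by auto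
  have AA: "A \<in> sets_of_size n j" using A by (simp add: sets_of_size_def)
  have out: "card {B \<in> sets_of_size n j. p ` B \<notin> S} = ?T - card S" if "p \<in> G" for p
  proof -
    have p: "p permutes ?V" using that by (simp add: G_def)
    have inj: "inj_on ((`) p) X" for X using permutes_inj[OF p] by (simp add: inj_on_def inj_image_eq_iff)
    have sub: "(`) p ` sets_of_size n j \<subseteq> sets_of_size n j"
    proof (intro image_subsetI)
      fix B assume "B \<in> sets_of_size n j"
      then show "p ` B \<in> sets_of_size n j"
        using permutes_image[OF p] by (auto simp: sets_of_size_def card_image permutes_inj_on[OF p])
    qed
    have surj: "(`) p ` sets_of_size n j = sets_of_size n j"
      by (rule card_subset_eq) (use sub in \<open>auto simp: card_image inj\<close>)
    have "(`) p ` {B \<in> sets_of_size n j. p ` B \<notin> S} = (`) p ` sets_of_size n j - S" by auto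
    also note surj
    finally have "(`) p ` {B \<in> sets_of_size n j. p ` B \<notin> S} = sets_of_size n j - S" .
    then have "card {B \<in> sets_of_size n j. p ` B \<notin> S} = card (sets_of_size n j - S)"
      by (metis card_image inj)
    then show ?thesis using S by (simp add: card_Diff_subset finite_subset)
  qed
  define g where "g = card {p\<in>G. p ` A \<in> S}"
  have g: "g * ?T = card G * card S"
    using card_permutes_image_in[of ?V A S] S A unfolding g_def G_def by (auto simp: sets_of_size_def)
  \<comment> \<open>Double counting of the pairs of a permutation and a \<open>j\<close>-set
    \<open>B\<close> such that the image of \<open>A\<close> is in \<open>S\<close> and that of
    \<open>B\<close> is not: exactly \<open>?T - card S\<close> sets \<open>B\<close> for each
    permutation counted by \<open>g\<close>, and at most \<open>j * X\<close> permutations for each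
    \<open>B\<close>.\<close>
  have "real g * real (?T - card S) = (\<Sum>p\<in>{p\<in>G. p ` A \<in> S}. real (card {B \<in> sets_of_size n j. p ` B \<notin> S}))"
    by (simp add: out g_def)
  also have "\<dots> = (\<Sum>p\<in>{p\<in>G. p ` A \<in> S}. \<Sum>B\<in>sets_of_size n j. if p ` B \<notin> S then 1 else 0)"
    by (intro sum.cong refl) (simp add: sum.If_cases Int_def)
  also have "\<dots> = (\<Sum>B\<in>sets_of_size n j. \<Sum>p\<in>{p\<in>G. p ` A \<in> S}. if p ` B \<notin> S then 1 else 0)"
    by (rule sum.swap)
  also have "\<dots> = (\<Sum>B\<in>sets_of_size n j. real (m A B))"
    unfolding m_def using finG by (intro sum.cong refl) (simp add: sum.If_cases Int_def conj_ac)
  also have "\<dots> \<le> (\<Sum>B\<in>sets_of_size n j. real j * X)"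
  proof (intro sum_mono)
    fix B assume B: "B \<in> sets_of_size n j"
    have "finite A" using A finite_subset by auto
    then have "card (A - B) \<le> j" using A by (metis Diff_subset card_mono)
    then have "real (card (A - B)) * X \<le> real j * X" using X0 by (intro mult_right_mono) auto
    then show "real (m A B) \<le> real j * X" using path[OF AA B] by linarith
  qed
  also have "\<dots> = real ?T * real j * X" by simp
  finally have 1: "real g * real (?T - card S) \<le> real ?T * real j * X" .
  have "real g * real ?T \<le> real g * (2 * real (?T - card S))"
    using s by (intro mult_left_mono) auto
  also have "\<dots> = 2 * (real g * real (?T - card S))" by (rule mult.left_commute)
  also have "\<dots> \<le> 2 * (real ?T * real j * X)" using 1 by (intro mult_left_mono) auto
  finally have "real g * real ?T \<le> 2 * real j * real ?T * X" by (simp only: mult_ac)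
  moreover have "real g * real ?T = real (card G) * real (card S)" using g by (metis of_nat_mult)
  ultimately have "real (card G) * real (card S) \<le> 2 * real j * real ?T * (real (card G) * real (card (crossing n k j S)) / real ?N)"
    by (simp add: X_def)
  then have "real (card G) * (real (card S) * real ?N) \<le> real (card G) * (2 * real j * real ?T * real (card (crossing n k j S)))"
    using N0 by (simp add: field_simps)
  then show ?thesis using G0 by (simp add: mult_le_cancel_left_pos)
qed

text \<open>Only \<open>k\<close>-sets containing exactly one member \<open>J\<close> of
  \<open>S\<close> are counted. Exchanging a vertex of \<open>J\<close> inside such a
  \<open>k\<close>-set gives a \<open>j\<close>-subset outside \<open>S\<close>, so the
  \<open>k\<close>-set is crossing, and the families for different \<open>J\<close> are disjoint.
  The subtracted term accounts for the supersets of \<open>J\<close> that contain a second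
  member.\<close>

lemma crossing_ge_small:
  assumes j: "1 \<le> j" "j < k" and kn: "k \<le> n" and S: "S \<subseteq> sets_of_size n j"
  shows "real (card S) * (real ((n - j) choose (k - j)) - real (card S) * real ((n - Suc j) choose (k - Suc j)))
    \<le> real (card (crossing n k j S))"
proof -
  define U where "U J = {e \<in> sets_of_size n k. J \<subseteq> e}" for J
  define W where "W J = U J - (\<Union>J'\<in>S - {J}. U J')" for J
  have finS: "finite S" using S by (rule finite_subset) simp
  have finU: "finite (U J)" for J by (simp add: U_def)
  have cU: "card (U J) = (n - j) choose (k - j)" if "J \<in> S" for J
    using that S j card_sets_of_size_superset[of J n k] by (auto simp: U_def sets_of_size_def)
  have cUU: "card (U J \<inter> U J') \<le> (n - Suc j) choose (k - Suc j)" if "J \<in> S" "J' \<in> S" "J \<noteq> J'" for J J'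
    unfolding U_def using that S j by (intro card_superset_both_le) auto
  have cW: "real ((n - j) choose (k - j)) - real (card S) * real ((n - Suc j) choose (k - Suc j)) \<le> real (card (W J))"
    if J: "J \<in> S" for J
  proof -
    have "U J \<subseteq> W J \<union> (\<Union>J'\<in>S - {J}. U J \<inter> U J')" by (auto simp: W_def)
    then have "card (U J) \<le> card (W J \<union> (\<Union>J'\<in>S - {J}. U J \<inter> U J'))"
      using finS finU by (intro card_mono) (auto simp: W_def)
    also have "\<dots> \<le> card (W J) + card (\<Union>J'\<in>S - {J}. U J \<inter> U J')" by (rule card_Un_le)
    also have "card (\<Union>J'\<in>S - {J}. U J \<inter> U J') \<le> (\<Sum>J'\<in>S - {J}. card (U J \<inter> U J'))"
      using finS by (intro card_UN_le) auto
    also have "\<dots> \<le> (\<Sum>J'\<in>S - {J}. (n - Suc j) choose (k - Suc j))"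
      by (intro sum_mono cUU J) auto
    also have "\<dots> \<le> card S * ((n - Suc j) choose (k - Suc j))"
      using finS by (simp add: mult_right_mono card_Diff1_le)
    finally have "card (U J) \<le> card (W J) + card S * ((n - Suc j) choose (k - Suc j))" by simp
    then have "real (card (U J)) \<le> real (card (W J)) + real (card S) * real ((n - Suc j) choose (k - Suc j))"
      by (metis of_nat_add of_nat_le_iff of_nat_mult)
    then show ?thesis using cU[OF J] by simp
  qed
  have "(\<Union>J\<in>S. W J) \<subseteq> crossing n k j S"
  proof
    fix e assume "e \<in> (\<Union>J\<in>S. W J)"
    then obtain J where J: "J \<in> S" "e \<in> sets_of_size n k" "J \<subseteq> e" "\<And>J'. J' \<in> S \<Longrightarrow> J' \<subseteq> e \<Longrightarrow> J' = J"
      by (auto simp: W_def U_def)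
    have c: "card J = j" "card e = k" using J(1,2) S by (auto simp: sets_of_size_def)
    then have fin: "finite J" "finite e" using j by (auto intro: card_ge_0_finite)
    obtain y where y: "y \<in> J" using c j by (metis card.empty ex_in_conv not_one_le_zero)
    obtain x where x: "x \<in> e" "x \<notin> J" using c j J(3) by (metis less_irrefl subsetI subset_antisym)
    define J' where "J' = insert x (J - {y})"
    have "card J' = j" using x y fin c j by (simp add: J'_def card_Diff_singleton)
    moreover have "J' \<subseteq> e" using x J(3) by (auto simp: J'_def)
    moreover have "J' \<notin> S" using J(4)[of J'] x \<open>J' \<subseteq> e\<close> by (auto simp: J'_def)
    ultimately show "e \<in> crossing n k j S" using J(1-3) unfolding crossing_def by blast
  qed
  then have "card (\<Union>J\<in>S. W J) \<le> card (crossing n k j S)"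
    by (intro card_mono) (auto simp: crossing_def)
  moreover have "card (\<Union>J\<in>S. W J) = (\<Sum>J\<in>S. card (W J))"
    by (rule card_UN_disjoint) (auto simp: finS W_def finU)
  ultimately have "(\<Sum>J\<in>S. real (card (W J))) \<le> real (card (crossing n k j S))"
    by (metis of_nat_le_iff of_nat_sum)
  moreover have "(\<Sum>J\<in>S. real ((n - j) choose (k - j)) - real (card S) * real ((n - Suc j) choose (k - Suc j))) \<le> (\<Sum>J\<in>S. real (card (W J)))"
    by (intro sum_mono cW)
  ultimately show ?thesis by simp
qed

section \<open>Components\<close>

definition shadow :: "nat \<Rightarrow> nat set set \<Rightarrow> nat set set" where
  "shadow j C = {J. card J = j \<and> (\<exists>e\<in>C. J \<subseteq> e)}"

definition overlap :: "nat \<Rightarrow> nat set \<Rightarrow> nat set \<Rightarrow> bool" where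
  "overlap j e e' \<longleftrightarrow> j \<le> card (e \<inter> e')"

definition overlap_rel :: "nat \<Rightarrow> nat set set \<Rightarrow> (nat set \<times> nat set) set" where
  "overlap_rel j E = {(e, e'). e \<in> E \<and> e' \<in> E \<and> overlap j e e'}"

lemma overlap_iff_common_subset:
  assumes "finite e"
  shows "overlap j e e' \<longleftrightarrow> (\<exists>J. card J = j \<and> J \<subseteq> e \<and> J \<subseteq> e')"
proof
  assume "overlap j e e'"
  then obtain J where "J \<subseteq> e \<inter> e'" "card J = j"
    unfolding overlap_def by (meson obtain_subset_with_card_n)
  then show "\<exists>J. card J = j \<and> J \<subseteq> e \<and> J \<subseteq> e'" by auto
next
  assume "\<exists>J. card J = j \<and> J \<subseteq> e \<and> J \<subseteq> e'"
  then show "overlap j e e'" using assms unfolding overlap_def by (metis Int_greatest card_mono finite_Int)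
qed

lemma overlap_rel_path:
  assumes "(e, e') \<in> (overlap_rel j E)\<^sup>*" "e \<in> E"
  shows "\<exists>p. p \<noteq> [] \<and> set p \<subseteq> E \<and> hd p = e \<and> last p = e' \<and> successively (\<lambda>e e'. j \<le> card (e \<inter> e')) p"
  using assms(1)
proof (induction rule: rtrancl_induct)
  case base
  then show ?case using assms(2) by (intro exI[of _ "[e]"]) auto
next
  case (step y z)
  then obtain p where "p \<noteq> []" "set p \<subseteq> E" "hd p = e" "last p = y" "successively (\<lambda>e e'. j \<le> card (e \<inter> e')) p"
    by blast
  then show ?case using step(2)
    by (intro exI[of _ "p @ [z]"]) (auto simp: successively_append_iff overlap_rel_def overlap_def)
qed

lemma overlap_rel_reachable_subset:
  assumes "e \<in> E"
  shows "{f. (e, f) \<in> (overlap_rel j E)\<^sup>*} \<subseteq> E"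
proof
  fix f assume "f \<in> {f. (e, f) \<in> (overlap_rel j E)\<^sup>*}"
  then have "(e, f) \<in> (overlap_rel j E)\<^sup>*" by simp
  then show "f \<in> E" by (cases rule: rtranclE) (use assms in \<open>auto simp: overlap_rel_def\<close>)
qed

lemma sym_overlap_rel: "sym (overlap_rel j E)"
  by (auto simp: sym_def overlap_rel_def overlap_def Int_commute)

lemma overlap_rel_mono: "E \<subseteq> E' \<Longrightarrow> overlap_rel j E \<subseteq> overlap_rel j E'"
  by (auto simp: overlap_rel_def)

lemma grown_refl: "grown R A A"
  by (auto simp: grown_def)

lemma grown_insert:
  assumes "grown R A C" "u \<in> C" "R u f"
  shows "grown R A (insert f C)"
  unfolding grown_def
proof (intro conjI allI impI)
  show "A \<subseteq> insert f C" using assms by (auto simp: grown_def)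
  fix X assume X: "A \<subseteq> X \<and> X \<subset> insert f C"
  show "\<exists>u\<in>X. \<exists>v\<in>insert f C - X. R u v"
  proof (cases "C \<subseteq> X")
    case True
    then have "u \<in> X" "f \<notin> X" using X assms(2) by auto
    then show ?thesis using assms(3) by blast
  next
    case False
    then have "A \<subseteq> X \<inter> C \<and> X \<inter> C \<subset> C" using X assms(1) by (auto simp: grown_def)
    then obtain u' v where "u' \<in> X \<inter> C" "v \<in> C - X \<inter> C" "R u' v"
      using assms(1) unfolding grown_def by blast
    then show ?thesis by blast
  qed
qed

lemma finite_shadow:
  assumes "C \<subseteq> sets_of_size n k" shows "finite (shadow j C)" "shadow j C \<subseteq> sets_of_size n j"
proof -
  show "shadow j C \<subseteq> sets_of_size n j" using assms unfolding shadow_def sets_of_size_def by blast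
  then show "finite (shadow j C)" using finite_sets_of_size finite_subset by blast
qed

lemma card_shadow_singleton:
  assumes "e \<in> sets_of_size n k"
  shows "card (shadow j {e}) = k choose j"
proof -
  have "finite e" using assms by (rule finite_mem_sets_of_size)
  then have "card {J. J \<subseteq> e \<and> card J = j} = card e choose j" by (rule n_subsets)
  moreover have "shadow j {e} = {J. J \<subseteq> e \<and> card J = j}" by (auto simp: shadow_def)
  ultimately show ?thesis using assms by (simp add: sets_of_size_def)
qed

lemma shadow_mono: "C \<subseteq> C' \<Longrightarrow> shadow j C \<subseteq> shadow j C'"
  by (auto simp: shadow_def)

lemma shadow_eq_UN: "shadow j C = (\<Union>f\<in>C. shadow j {f})"
  by (auto simp: shadow_def)

text \<open>
  Explore the component of \<open>e\<close> using only edges that cover a new \<open>j\<close>-set; this keeps the number of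
  edges below the number of covered \<open>j\<close>-sets, which the whole component need not satisfy.
\<close>

lemma exists_sparse_grown_subset:
  assumes E: "E \<subseteq> sets_of_size n k" and e: "e \<in> E" and jk: "j \<le> k"
    and C: "C = {f. (e, f) \<in> (overlap_rel j E)\<^sup>*}"
  shows "\<exists>C'\<subseteq>C. grown (overlap j) {e} C' \<and> shadow j C' = shadow j C \<and> card C' \<le> card (shadow j C')"
proof -
  have "C \<subseteq> E" unfolding C using e by (rule overlap_rel_reachable_subset)
  then have CK: "C \<subseteq> sets_of_size n k" using E by auto
  have finC: "finite C" using CK finite_subset finite_sets_of_size by blast
  have fe: "finite f" if "f \<in> C" for f using that CK finite_mem_sets_of_size by blast
  have eC: "e \<in> C" by (simp add: C)
  \<comment> \<open>A member of maximal size is taken below; it cannot be enlarged by an edge that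
    covers a new \<open>j\<close>-set.\<close>
  define \<G> where "\<G> = {C'. C' \<subseteq> C \<and> grown (overlap j) {e} C' \<and> card C' \<le> card (shadow j C')}"
  have finG: "finite \<G>" by (rule finite_subset[of _ "Pow C"]) (auto simp: \<G>_def finC)
  have "{e} \<in> \<G>" using eC E e jk card_shadow_singleton[of e n k j] by (auto simp: \<G>_def grown_refl Suc_le_eq)
  then have "Max (card ` \<G>) \<in> card ` \<G>" using finG by (intro Max_in) auto
  then obtain C' where C': "C' \<in> \<G>" "card C' = Max (card ` \<G>)" by auto
  have max: "card D \<le> card C'" if "D \<in> \<G>" for D using finG that C'(2) by simp
  have C'C: "C' \<subseteq> C" and gr: "grown (overlap j) {e} C'" and le: "card C' \<le> card (shadow j C')"
    using C' by (auto simp: \<G>_def)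
  \<comment> \<open>Otherwise adding \<open>f\<close> would raise the number of edges by one and the
    number of covered \<open>j\<close>-sets by at least one, contradicting maximality.\<close>
  have closed: "shadow j {f} \<subseteq> shadow j C'" if f: "f \<in> C" "u \<in> C'" "overlap j u f" for u f
  proof (rule ccontr)
    assume n: "\<not> shadow j {f} \<subseteq> shadow j C'"
    then have fC': "f \<notin> C'" by (auto simp: shadow_def)
    have "shadow j C' \<subset> shadow j (insert f C')" using n shadow_mono[of C' "insert f C'" j] shadow_mono[of "{f}" "insert f C'" j] by blast
    moreover have "finite (shadow j (insert f C'))" using C'C f CK by (intro finite_shadow(1)[of _ n k]) auto
    ultimately have "card (shadow j C') < card (shadow j (insert f C'))" by (simp add: psubset_card_mono)
    then have "insert f C' \<in> \<G>"
      using C'C f le fC' finC finite_subset[OF C'C finC] grown_insert[OF gr f(2,3)] by (auto simp: \<G>_def)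
    then have "card (insert f C') \<le> card C'" by (rule max)
    then show False using fC' finite_subset[OF C'C finC] by simp
  qed
  have "shadow j {f} \<subseteq> shadow j C'" if "f \<in> C" for f
  proof -
    from that have "(e, f) \<in> (overlap_rel j E)\<^sup>*" by (simp add: C)
    then show ?thesis
    proof (induction rule: rtrancl_induct)
      case base
      have "{e} \<subseteq> C'" using gr by (auto simp: grown_def)
      then show ?case by (rule shadow_mono)
    next
      case (step y z)
      have yC: "y \<in> C" "z \<in> C" using step by (auto simp: C)
      \<comment> \<open>The edge \<open>y\<close> need not be in \<open>C'\<close>, but its
        \<open>j\<close>-subset shared with \<open>z\<close> is covered by some \<open>g\<close> in
        \<open>C'\<close>, and \<open>g\<close> takes over the role of \<open>y\<close>.\<close>
      have "overlap j y z" using step by (simp add: overlap_rel_def)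
      then obtain J where J: "card J = j" "J \<subseteq> y" "J \<subseteq> z" using fe[OF yC(1)] overlap_iff_common_subset by blast
      then have "J \<in> shadow j C'" using step.IH by (auto simp: shadow_def)
      then obtain g where g: "g \<in> C'" "J \<subseteq> g" by (auto simp: shadow_def)
      then have "overlap j g z" using J fe C'C overlap_iff_common_subset by blast
      then show ?case using closed[OF yC(2) g(1)] by simp
    qed
  qed
  then have "shadow j C \<subseteq> shadow j C'" by (subst shadow_eq_UN) blast
  then have "shadow j C' = shadow j C" using shadow_mono[OF C'C, of j] by auto
  then show ?thesis using C'C gr le by blast
qed

text \<open>The obstruction in a form suited to a union bound: for fixed \<open>C\<close>, the set
  \<open>E\<close> enters only through the presence of given \<open>k\<close>-sets and the absence
  of others.\<close>

definition separated :: "nat \<Rightarrow> nat \<Rightarrow> nat \<Rightarrow> nat set set \<Rightarrow> nat set set \<Rightarrow> bool" where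
  "separated n k j E C \<longleftrightarrow> card C \<le> card (shadow j C) \<and> 2 * card (shadow j C) \<le> n choose j \<and>
     C \<subseteq> E \<and> crossing n k j (shadow j C) \<inter> E = {}"

text \<open>Two components have disjoint shadows, since a common \<open>j\<close>-set would link
  them, so one of the shadows contains at most half of all \<open>j\<close>-sets. The sparse subset
  of that component has the same shadow, hence the same crossing \<open>k\<close>-sets, and none of
  these is an edge.\<close>

lemma unlinked_imp_separated:
  assumes E: "E \<subseteq> sets_of_size n k" and jk: "j \<le> k" and e: "e1 \<in> E" "e2 \<in> E"
    and un: "(e1, e2) \<notin> (overlap_rel j E)\<^sup>*"
  shows "\<exists>e\<in>E. \<exists>C. grown (overlap j) {e} C \<and> separated n k j E C"
proof -
  define Cp where "Cp e = {f. (e, f) \<in> (overlap_rel j E)\<^sup>*}" for e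
  have symr: "(x, y) \<in> (overlap_rel j E)\<^sup>* \<Longrightarrow> (y, x) \<in> (overlap_rel j E)\<^sup>*" for x y
    using sym_rtrancl[OF sym_overlap_rel] by (auto simp: sym_def)
  have CE: "Cp e \<subseteq> E" if "e \<in> E" for e
    unfolding Cp_def using that by (rule overlap_rel_reachable_subset)
  have fe: "finite f" if "f \<in> E" for f using that E finite_mem_sets_of_size by blast
  have disj: "shadow j (Cp e1) \<inter> shadow j (Cp e2) = {}"
  proof (rule ccontr)
    assume "shadow j (Cp e1) \<inter> shadow j (Cp e2) \<noteq> {}"
    then obtain J f g where J: "card J = j" "J \<subseteq> f" "J \<subseteq> g" "f \<in> Cp e1" "g \<in> Cp e2"
      by (auto simp: shadow_def)
    then have fg: "f \<in> E" "g \<in> E" using CE e by auto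
    then have "overlap j f g" using J fe overlap_iff_common_subset by blast
    then have "(f, g) \<in> overlap_rel j E" using fg by (simp add: overlap_rel_def)
    then have "(e1, g) \<in> (overlap_rel j E)\<^sup>*" using J(4) by (simp add: Cp_def)
    moreover have "(g, e2) \<in> (overlap_rel j E)\<^sup>*" using J(5) symr by (simp add: Cp_def)
    ultimately show False using un by (meson rtrancl_trans)
  qed
  have sub: "shadow j (Cp e) \<subseteq> sets_of_size n j" "finite (shadow j (Cp e))" if "e \<in> E" for e
    using finite_shadow[of "Cp e" n k j] CE[OF that] E by auto
  have "card (shadow j (Cp e1)) + card (shadow j (Cp e2)) = card (shadow j (Cp e1) \<union> shadow j (Cp e2))"
    using sub e disj by (simp add: card_Un_disjoint)
  also have "\<dots> \<le> card (sets_of_size n j)" using sub e by (intro card_mono) auto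
  finally have "2 * card (shadow j (Cp e1)) \<le> n choose j \<or> 2 * card (shadow j (Cp e2)) \<le> n choose j"
    by (simp, linarith)
  then obtain e where e: "e \<in> E" "2 * card (shadow j (Cp e)) \<le> n choose j" using e by blast
  obtain C where C: "C \<subseteq> Cp e" "grown (overlap j) {e} C" "shadow j C = shadow j (Cp e)" "card C \<le> card (shadow j C)"
    using exists_sparse_grown_subset[OF E e(1) jk, of "Cp e"] by (auto simp: Cp_def)
  have "crossing n k j (shadow j (Cp e)) \<inter> E = {}"
  proof (rule ccontr)
    assume "crossing n k j (shadow j (Cp e)) \<inter> E \<noteq> {}"
    then obtain f J J' where f: "f \<in> E" "J \<in> shadow j (Cp e)" "J \<subseteq> f" "J' \<subseteq> f" "card J' = j" "J' \<notin> shadow j (Cp e)"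
      unfolding crossing_def by auto
    obtain g where g: "g \<in> Cp e" "J \<subseteq> g" "card J = j" using f(2) by (auto simp: shadow_def)
    then have "g \<in> E" using CE e by auto
    then have "(g, f) \<in> overlap_rel j E" using f(1,3) g fe overlap_iff_common_subset by (auto simp: overlap_rel_def)
    then have "f \<in> Cp e" using g(1) by (simp add: Cp_def)
    then show False using f by (auto simp: shadow_def)
  qed
  then show ?thesis using C e CE[OF e(1)] unfolding separated_def by (intro bexI[of _ e] exI[of _ C]) auto
qed

lemma edges_at_mono: "M \<le> M' \<Longrightarrow> edges_at es M \<subseteq> edges_at es M'"
  unfolding edges_at_def by (rule set_take_subset_set_take)

text \<open>The deterministic part. \<open>G1\<close> and \<open>G2\<close> place
  \<open>tau_I\<close> between \<open>M0\<close> and \<open>M1\<close>; \<open>G3\<close> gives a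
  single component at time \<open>M0\<close>, and \<open>G4\<close> keeps it single up to
  \<open>M1\<close>. So at time \<open>tau_I\<close> every \<open>j\<close>-set is covered and all
  edges are linked.\<close>

lemma hitting_times_eq:
  assumes j: "1 \<le> j" "j < k" and kn: "k \<le> n"
    and es: "es \<in> distinct_lists (sets_of_size n k) (n choose k)"
    and M: "M0 \<le> M1" "M1 \<le> n choose k"
    and G1: "\<exists>J\<in>sets_of_size n j. isolated (edges_at es M0) J"
    and G2: "\<forall>J\<in>sets_of_size n j. \<not> isolated (edges_at es M1) J"
    and G3: "\<not> (\<exists>e\<in>sets_of_size n k. \<exists>C. grown (overlap j) {e} C \<and> separated n k j (edges_at es M0) C)"
    and G4: "\<forall>t. M0 \<le> t \<and> t < M1 \<longrightarrow> \<not> (\<forall>J. J \<subseteq> es ! t \<and> card J = j \<longrightarrow> isolated (edges_at es t) J)"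
  shows "tau_C n j es = tau_I n j es"
proof -
  have EK: "edges_at es t \<subseteq> sets_of_size n k" for t
    using es set_take_subset[of t es] by (auto simp: edges_at_def distinct_lists_def)
  have fe: "finite f" if "f \<in> edges_at es t" for f t
    using that EK finite_mem_sets_of_size by blast
  have linked: "\<forall>e\<in>edges_at es t. \<forall>f\<in>edges_at es t. (e, f) \<in> (overlap_rel j (edges_at es t))\<^sup>*"
    if "M0 \<le> t" "t \<le> M1" for t
    using that
  proof (induction t rule: dec_induct)
    case base
    show ?case using unlinked_imp_separated[OF EK, of j] G3 EK j
      by (metis less_imp_le subsetD)
  next
    case (step t)
    let ?E = "edges_at es t" and ?E' = "edges_at es (Suc t)"
    define e where "e = es ! t"
    have tl: "t < length es" using step M es by (auto simp: distinct_lists_def)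
    have E': "?E' = insert e ?E" using tl by (simp add: edges_at_def take_Suc_conv_app_nth e_def)
    \<comment> \<open>The new edge contains a \<open>j\<close>-set that an earlier edge
      \<open>g\<close> already covers, so it attaches to the existing component.\<close>
    obtain J where J: "J \<subseteq> e" "card J = j" "\<not> isolated ?E J" using G4 step by (auto simp: e_def)
    then obtain g where g: "g \<in> ?E" "J \<subseteq> g" by (auto simp: isolated_def)
    have "overlap j g e" using g J fe overlap_iff_common_subset by blast
    then have ge: "(g, e) \<in> overlap_rel j ?E'" using g E' by (auto simp: overlap_rel_def)
    then have eg: "(e, g) \<in> overlap_rel j ?E'" using sym_overlap_rel by (metis symD)
    have old: "(a, b) \<in> (overlap_rel j ?E')\<^sup>*" if "a \<in> ?E" "b \<in> ?E" for a b
      using step that rtrancl_mono[OF overlap_rel_mono, of ?E ?E' j] E' by auto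
    have "(a, g) \<in> (overlap_rel j ?E')\<^sup>* \<and> (g, a) \<in> (overlap_rel j ?E')\<^sup>*" if "a \<in> ?E'" for a
      using that old g ge eg E' by auto
    then show ?case by (meson rtrancl_trans)
  qed
  define \<tau> where "\<tau> = tau_I n j es"
  have noiso: "\<forall>J\<in>sets_of_size n j. \<not> isolated (edges_at es \<tau>) J"
    unfolding \<tau>_def tau_I_def by (rule LeastI_ex) (use G2 in blast)
  have \<tau>1: "\<tau> \<le> M1" unfolding \<tau>_def tau_I_def using G2 by (intro Least_le)
  have \<tau>0: "M0 \<le> \<tau>"
  proof (rule ccontr)
    assume "\<not> M0 \<le> \<tau>"
    then have "edges_at es \<tau> \<subseteq> edges_at es M0" by (intro edges_at_mono) auto
    then show False using G1 noiso unfolding isolated_def by blast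
  qed
  have conn: "j_connected n j (edges_at es \<tau>)"
    unfolding j_connected_def
  proof (intro ballI impI)
    fix J J' assume J: "J \<in> sets_of_size n j" "J' \<in> sets_of_size n j"
    have "\<exists>e\<in>edges_at es \<tau>. I \<subseteq> e" if "I \<in> sets_of_size n j" for I
      using noiso that by (auto simp: isolated_def)
    then obtain e f where ef: "e \<in> edges_at es \<tau>" "f \<in> edges_at es \<tau>" "J \<subseteq> e" "J' \<subseteq> f"
      using J by metis
    then have "(e, f) \<in> (overlap_rel j (edges_at es \<tau>))\<^sup>*" using linked[OF \<tau>0 \<tau>1] by blast
    then show "j_connected_sets j (edges_at es \<tau>) J J'"
      using overlap_rel_path[of e f j "edges_at es \<tau>"] ef unfolding j_connected_sets_def by blast
  qed
  have "tau_C n j es \<le> \<tau>" unfolding tau_C_def by (rule Least_le) (rule conn)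
  moreover have "\<tau> \<le> tau_C n j es"
  proof -
    have c: "j_connected n j (edges_at es (tau_C n j es))"
      unfolding tau_C_def by (rule LeastI) (rule conn)
    \<comment> \<open>Connectivity speaks only of distinct \<open>j\<close>-sets, so a second one is
      made by exchanging a vertex; the path to it starts with an edge containing
      \<open>J\<close>.\<close>
    have "\<not> isolated (edges_at es (tau_C n j es)) J" if J: "J \<in> sets_of_size n j" for J
    proof -
      have "J \<subseteq> {1..n}" "card J = j" using J by (auto simp: sets_of_size_def)
      then have fin: "finite J" and ne: "J \<noteq> {}" "J \<noteq> {1..n}" using j kn finite_subset by auto
      then obtain x y where xy: "x \<in> J" "y \<in> {1..n}" "y \<notin> J" using \<open>J \<subseteq> {1..n}\<close> by blast
      define J' where "J' = insert y (J - {x})"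
      have "card J' = j" using xy fin \<open>card J = j\<close> j by (simp add: J'_def card_Diff_singleton)
      then have "J' \<in> sets_of_size n j" using xy \<open>J \<subseteq> {1..n}\<close> by (auto simp: J'_def sets_of_size_def)
      moreover have "J \<noteq> J'" using xy by (auto simp: J'_def)
      ultimately have "j_connected_sets j (edges_at es (tau_C n j es)) J J'"
        using c J unfolding j_connected_def by blast
      then show ?thesis unfolding j_connected_sets_def isolated_def by (metis hd_in_set subsetD)
    qed
    then show ?thesis unfolding \<tau>_def tau_I_def by (intro Least_le) blast
  qed
  ultimately show ?thesis by (simp add: \<tau>_def)
qed

section \<open>Probability bounds\<close>

lemma prob_edges_at_between_le:
  assumes A: "A \<subseteq> sets_of_size n k" and B: "B \<subseteq> sets_of_size n k" and aM: "card A \<le> M" and M: "M \<le> n choose k"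
  shows "measure_pmf.prob (hypergraph_process k n) {es. A \<subseteq> edges_at es M \<and> B \<inter> edges_at es M = {}}
    \<le> (real M / real (n choose k)) ^ card A * exp (- (real (card B) * real (M - card A) / real (n choose k)))"
proof (cases "A \<inter> B = {}")
  case True
  have "measure_pmf.prob (hypergraph_process k n) {es. A \<subseteq> edges_at es M \<and> B \<inter> edges_at es M = {}}
    = measure_pmf.prob (pmf_of_set (distinct_lists (sets_of_size n k) M)) {es. A \<subseteq> set es \<and> B \<inter> set es = {}}"
    unfolding edges_at_def by (rule prob_hypergraph_process_take[OF M])
  then show ?thesis
    using prob_distinct_lists_between_le[OF finite_sets_of_size A B, of M] True aM M by simp
next
  case False
  then have "{es. A \<subseteq> edges_at es M \<and> B \<inter> edges_at es M = {}} = {}" by blast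
  then show ?thesis by (simp only: measure_empty) simp
qed

lemma prob_UN_le_sum:
  assumes "finite I"
  shows "measure_pmf.prob p (\<Union>i\<in>I. A i) \<le> (\<Sum>i\<in>I. measure_pmf.prob p (A i))"
  by (rule measure_pmf.finite_measure_subadditive_finite) (use assms in auto)

text \<open>First moment: a \<open>j\<close>-set is isolated when all its \<open>k\<close>-supersets
  are absent.\<close>

lemma prob_exists_isolated_le:
  assumes jk: "j \<le> k" and M: "M \<le> n choose k"
  shows "measure_pmf.prob (hypergraph_process k n) {es. \<exists>J\<in>sets_of_size n j. isolated (edges_at es M) J}
    \<le> real (n choose j) * exp (- (real ((n - j) choose (k - j)) * real M / real (n choose k)))"
proof -
  let ?p = "hypergraph_process k n"
  define U where "U J = {e \<in> sets_of_size n k. J \<subseteq> e}" for J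
  have "measure_pmf.prob ?p {es. \<exists>J\<in>sets_of_size n j. isolated (edges_at es M) J}
    \<le> measure_pmf.prob ?p (\<Union>J\<in>sets_of_size n j. {es. {} \<subseteq> edges_at es M \<and> U J \<inter> edges_at es M = {}})"
    by (intro measure_pmf.finite_measure_mono) (auto simp: isolated_def U_def)
  also have "\<dots> \<le> (\<Sum>J\<in>sets_of_size n j. measure_pmf.prob ?p {es. {} \<subseteq> edges_at es M \<and> U J \<inter> edges_at es M = {}})"
    by (rule prob_UN_le_sum) simp
  also have "\<dots> \<le> (\<Sum>J\<in>sets_of_size n j. exp (- (real ((n - j) choose (k - j)) * real M / real (n choose k))))"
  proof (intro sum_mono)
    fix J assume "J \<in> sets_of_size n j"
    then have "card (U J) = (n - j) choose (k - j)"
      using card_sets_of_size_superset[of J n k] jk by (auto simp: U_def sets_of_size_def)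
    then show "measure_pmf.prob ?p {es. {} \<subseteq> edges_at es M \<and> U J \<inter> edges_at es M = {}}
       \<le> exp (- (real ((n - j) choose (k - j)) * real M / real (n choose k)))"
      using prob_edges_at_between_le[of "{}" n k "U J" M] M by (auto simp: U_def)
  qed
  finally show ?thesis by simp
qed

text \<open>The right-hand side is the exponent gained when \<open>m\<close> given edges are present
  and all crossing \<open>k\<close>-sets absent. Of this gain, \<beta> serves against the number of
  starting edges, and \<gamma> per edge against the number of connected sets. An edge covers
  \<open>k choose j\<close> sets, whence the lower bound on \<open>card S\<close>.\<close>

definition well_crossed :: "nat \<Rightarrow> nat \<Rightarrow> nat \<Rightarrow> nat \<Rightarrow> real \<Rightarrow> real \<Rightarrow> bool" where
  "well_crossed n k j M \<beta> \<gamma> \<longleftrightarrow>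
     (\<forall>S m. S \<subseteq> sets_of_size n j \<and> k choose j \<le> card S \<and> 2 * card S \<le> n choose j \<and> m \<le> card S \<longrightarrow>
        \<beta> + \<gamma> * real m \<le> real (card (crossing n k j S)) * real (M - m) / real (n choose k))"

lemma card_overlap_le:
  assumes "u \<in> sets_of_size n k" "j \<le> k"
  shows "card {v \<in> sets_of_size n k. overlap j u v} \<le> (k choose j) * ((n - j) choose (k - j))"
proof -
  have sh: "finite (shadow j {u})" "shadow j {u} \<subseteq> sets_of_size n j"
    using finite_shadow[of "{u}" n k j] assms by auto
  have "{v \<in> sets_of_size n k. overlap j u v} \<subseteq> (\<Union>J\<in>shadow j {u}. {v \<in> sets_of_size n k. J \<subseteq> v})"
    using overlap_iff_common_subset[OF finite_mem_sets_of_size[OF assms(1)]] by (auto simp: shadow_def)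
  then have "card {v \<in> sets_of_size n k. overlap j u v} \<le> card (\<Union>J\<in>shadow j {u}. {v \<in> sets_of_size n k. J \<subseteq> v})"
    using sh by (intro card_mono) auto
  also have "\<dots> \<le> (\<Sum>J\<in>shadow j {u}. card {v \<in> sets_of_size n k. J \<subseteq> v})" by (rule card_UN_le) (rule sh)
  also have "\<dots> = (\<Sum>J\<in>shadow j {u}. (n - j) choose (k - j))"
  proof (intro sum.cong refl)
    fix J assume "J \<in> shadow j {u}"
    then have "J \<subseteq> {1..n}" "card J = j" using sh by (auto simp: sets_of_size_def)
    then show "card {v \<in> sets_of_size n k. J \<subseteq> v} = (n - j) choose (k - j)"
      using card_sets_of_size_superset[of J n k] assms by auto
  qed
  finally show ?thesis using card_shadow_singleton[OF assms(1), of j] by simp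
qed

text \<open>Union bound over a root \<open>e\<close> and a connected \<open>C\<close> through it.
  Each \<open>C\<close> contributes at most \<open>x ^ card C * exp (- \<beta>)\<close> with
  \<open>x = M / N * exp (- \<gamma>)\<close>, where \<open>N = n choose k\<close>. The sum over
  \<open>C\<close> is at most \<open>2 * x * exp (- \<beta>)\<close> by the bound on connected sets,
  and the \<open>N\<close> roots turn \<open>x\<close> into at most \<open>M\<close>.\<close>

lemma prob_exists_separated_le:
  assumes jk: "j \<le> k" and kn: "k \<le> n" and M: "M \<le> n choose k" "n choose j \<le> 2 * M"
    and w: "well_crossed n k j M \<beta> \<gamma>" and \<gamma>: "0 \<le> \<gamma>"
    and x: "4 * real ((k choose j) * ((n - j) choose (k - j))) * (real M / real (n choose k) * exp (- \<gamma>)) \<le> 1"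
  shows "measure_pmf.prob (hypergraph_process k n)
      {es. \<exists>e\<in>sets_of_size n k. \<exists>C. grown (overlap j) {e} C \<and> separated n k j (edges_at es M) C}
    \<le> 2 * real M * exp (- \<beta>)"
proof -
  let ?p = "hypergraph_process k n" and ?V = "sets_of_size n k" and ?N = "n choose k"
  define x where "x = real M / real ?N * exp (- \<gamma>)"
  define F where "F e = {C. C \<subseteq> ?V \<and> grown (overlap j) {e} C}" for e
  define H where "H e = {C \<in> F e. card C \<le> card (shadow j C) \<and> 2 * card (shadow j C) \<le> n choose j}" for e
  define Ev where "Ev C = {es. C \<subseteq> edges_at es M \<and> crossing n k j (shadow j C) \<inter> edges_at es M = {}}" for C
  have finF: "finite (F e)" for e by (rule finite_subset[of _ "Pow ?V"]) (auto simp: F_def)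
  have finH: "finite (H e)" for e using finF by (simp add: H_def)
  have x0: "0 \<le> x" by (simp add: x_def)
  have Ev: "measure_pmf.prob ?p (Ev C) \<le> x ^ card C * exp (- \<beta>)" if C: "C \<in> H e" and e: "e \<in> ?V" for e C
  proof -
    have CV: "C \<subseteq> ?V" and c: "card C \<le> card (shadow j C)" "2 * card (shadow j C) \<le> n choose j" and "{e} \<subseteq> C"
      using C by (auto simp: H_def F_def grown_def)
    have "shadow j {e} \<subseteq> shadow j C" by (rule shadow_mono) fact
    then have "card (shadow j {e}) \<le> card (shadow j C)" using finite_shadow[OF CV] by (intro card_mono) auto
    then have q: "k choose j \<le> card (shadow j C)" using card_shadow_singleton[OF e] by simp
    have cM: "card C \<le> M" using c M by linarith
    let ?b = "real (card (crossing n k j (shadow j C)))"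
    have "\<beta> + \<gamma> * real (card C) \<le> ?b * real (M - card C) / real ?N"
      using w q c finite_shadow[OF CV] unfolding well_crossed_def by blast
    then have "exp (- (?b * real (M - card C) / real ?N)) \<le> exp (- (\<beta> + \<gamma> * real (card C)))" by simp
    also have "\<dots> = exp (- \<gamma>) ^ card C * exp (- \<beta>)"
      by (simp add: exp_of_nat_mult[symmetric] exp_add[symmetric] mult.commute)
    finally have 1: "exp (- (?b * real (M - card C) / real ?N)) \<le> exp (- \<gamma>) ^ card C * exp (- \<beta>)" .
    have "measure_pmf.prob ?p (Ev C) \<le> (real M / real ?N) ^ card C * exp (- (?b * real (M - card C) / real ?N))"
      unfolding Ev_def by (rule prob_edges_at_between_le) (use CV cM M in \<open>auto simp: crossing_def\<close>)
    also have "\<dots> \<le> (real M / real ?N) ^ card C * (exp (- \<gamma>) ^ card C * exp (- \<beta>))"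
      by (intro mult_left_mono 1) auto
    finally show ?thesis by (simp only: x_def power_mult_distrib mult.assoc)
  qed
  have "measure_pmf.prob ?p {es. \<exists>e\<in>?V. \<exists>C. grown (overlap j) {e} C \<and> separated n k j (edges_at es M) C}
    \<le> measure_pmf.prob ?p (\<Union>e\<in>?V. \<Union>C\<in>H e. Ev C)"
  \<comment> \<open>The inclusion is claimed for runs in the support, whose edges are indeed
    \<open>k\<close>-sets of vertices.\<close>
  proof (rule measure_pmf.finite_measure_mono_AE)
    show "AE es in measure_pmf ?p. es \<in> {es. \<exists>e\<in>?V. \<exists>C. grown (overlap j) {e} C \<and> separated n k j (edges_at es M) C}
      \<longrightarrow> es \<in> (\<Union>e\<in>?V. \<Union>C\<in>H e. Ev C)"
    proof (rule AE_pmfI)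
      fix es assume "es \<in> set_pmf ?p"
      then have "set es \<subseteq> ?V" using set_pmf_first_edges[of ?N n k] by (auto simp: hypergraph_process_def distinct_lists_def)
      then have "edges_at es M \<subseteq> ?V" using set_take_subset[of M es] by (auto simp: edges_at_def)
      then have "C \<in> H e \<and> es \<in> Ev C" if "grown (overlap j) {e} C" "separated n k j (edges_at es M) C" for e C
        using that by (auto simp: separated_def H_def F_def Ev_def)
      then show "es \<in> {es. \<exists>e\<in>?V. \<exists>C. grown (overlap j) {e} C \<and> separated n k j (edges_at es M) C}
        \<longrightarrow> es \<in> (\<Union>e\<in>?V. \<Union>C\<in>H e. Ev C)" by blast
    qed
  qed auto
  also have "\<dots> \<le> (\<Sum>e\<in>?V. measure_pmf.prob ?p (\<Union>C\<in>H e. Ev C))" by (rule prob_UN_le_sum) simp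
  also have "\<dots> \<le> (\<Sum>e\<in>?V. 2 * x * exp (- \<beta>))"
  proof (intro sum_mono)
    fix e assume e: "e \<in> ?V"
    have "measure_pmf.prob ?p (\<Union>C\<in>H e. Ev C) \<le> (\<Sum>C\<in>H e. measure_pmf.prob ?p (Ev C))"
      by (rule prob_UN_le_sum) (rule finH)
    also have "\<dots> \<le> (\<Sum>C\<in>H e. x ^ card C * exp (- \<beta>))" by (intro sum_mono Ev[OF _ e])
    also have "\<dots> \<le> (\<Sum>C\<in>F e. x ^ card C * exp (- \<beta>))"
      by (intro sum_mono2 finF) (use x0 in \<open>auto simp: H_def\<close>)
    also have "\<dots> = (\<Sum>C\<in>F e. x ^ card C) * exp (- \<beta>)" by (simp add: sum_distrib_right)
    also have "(\<Sum>C\<in>F e. x ^ card C) \<le> 2 * x"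
      unfolding F_def
    proof (rule sum_power_card_grown_le[OF finite_sets_of_size e x0])
      show "4 * real ((k choose j) * ((n - j) choose (k - j))) * x \<le> 1" using x by (simp add: x_def)
      show "1 \<le> (k choose j) * ((n - j) choose (k - j))" using jk kn by (simp add: Suc_le_eq)
      show "card {v \<in> ?V. overlap j u v} \<le> (k choose j) * ((n - j) choose (k - j))" if "u \<in> ?V" for u
        by (rule card_overlap_le[OF that jk])
    qed
    finally show "measure_pmf.prob ?p (\<Union>C\<in>H e. Ev C) \<le> 2 * x * exp (- \<beta>)" by simp
  qed
  also have "\<dots> = 2 * (real M * exp (- \<gamma>)) * exp (- \<beta>)"
    using kn by (simp add: x_def)
  also have "\<dots> \<le> 2 * (real M * 1) * exp (- \<beta>)"
    using \<gamma> by (intro mult_right_mono mult_left_mono) auto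
  finally show ?thesis by simp
qed

text \<open>If all \<open>j\<close>-subsets of the newly added \<open>e\<close> were isolated, no
  \<open>k\<close>-set crossing the shadow of \<open>e\<close> was present before. A given
  \<open>e\<close> is the new edge with a weight of \<open>1 / (N - t)\<close>,
  \<open>N = n choose k\<close>, and there are \<open>N\<close> choices of \<open>e\<close>.\<close>

lemma prob_isolated_edge_at_step_le:
  assumes jk: "j \<le> k" and kn: "k \<le> n" and t: "M \<le> t" "t < n choose k"
    and w: "well_crossed n k j M \<beta> \<gamma>" and q: "2 * (k choose j) \<le> n choose j"
  shows "measure_pmf.prob (hypergraph_process k n)
      {es. \<forall>J. J \<subseteq> es ! t \<and> card J = j \<longrightarrow> isolated (edges_at es t) J}
    \<le> real (n choose k) * exp (- \<beta>) / real ((n choose k) - t)"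
proof -
  let ?p = "hypergraph_process k n" and ?V = "sets_of_size n k" and ?N = "n choose k"
  define B where "B e = crossing n k j (shadow j {e})" for e
  define Q where "Q e es \<longleftrightarrow> last es = e \<and> B e \<inter> set (butlast es) = {}" for e and es :: "nat set list"
  have "measure_pmf.prob ?p {es. \<forall>J. J \<subseteq> es ! t \<and> card J = j \<longrightarrow> isolated (edges_at es t) J}
     \<le> measure_pmf.prob ?p (\<Union>e\<in>?V. {es. Q e (take (Suc t) es)})"
  proof (rule measure_pmf.finite_measure_mono_AE)
    show "AE es in measure_pmf ?p. es \<in> {es. \<forall>J. J \<subseteq> es ! t \<and> card J = j \<longrightarrow> isolated (edges_at es t) J}
      \<longrightarrow> es \<in> (\<Union>e\<in>?V. {es. Q e (take (Suc t) es)})"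
    proof (rule AE_pmfI, rule impI)
      fix es assume "es \<in> set_pmf ?p" and iso: "es \<in> {es. \<forall>J. J \<subseteq> es ! t \<and> card J = j \<longrightarrow> isolated (edges_at es t) J}"
      then have es: "set es \<subseteq> ?V" "length es = ?N"
        using set_pmf_first_edges[of ?N n k] by (auto simp: hypergraph_process_def distinct_lists_def)
      then have "es ! t \<in> ?V" using t by (metis nth_mem subsetD)
      \<comment> \<open>Indices start at 0: \<open>es ! t\<close> is the last entry of
        \<open>take (Suc t) es\<close>, and \<open>edges_at es t\<close> is the set of the entries
        before it.\<close>
      moreover have "Q (es ! t) (take (Suc t) es)"
        using iso es t by (auto simp: Q_def take_Suc_conv_app_nth B_def crossing_def shadow_def isolated_def edges_at_def)
      ultimately show "es \<in> (\<Union>e\<in>?V. {es. Q e (take (Suc t) es)})" by blast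
    qed
  qed auto
  also have "\<dots> \<le> (\<Sum>e\<in>?V. measure_pmf.prob ?p {es. Q e (take (Suc t) es)})" by (rule prob_UN_le_sum) simp
  also have "\<dots> \<le> (\<Sum>e\<in>?V. exp (- \<beta>) / real (?N - t))"
  proof (intro sum_mono)
    fix e assume e: "e \<in> ?V"
    have "measure_pmf.prob ?p {es. Q e (take (Suc t) es)}
       = measure_pmf.prob (pmf_of_set (distinct_lists ?V (Suc t))) {es. Q e es}"
      by (rule prob_hypergraph_process_take) (use t in simp)
    also have "\<dots> \<le> exp (- (real (card (B e)) * real t / real ?N)) / real (?N - t)"
      using prob_distinct_lists_last_le[of ?V "B e" t e] t by (auto simp: Q_def B_def crossing_def)
    also have "\<dots> \<le> exp (- \<beta>) / real (?N - t)"
    proof (intro divide_right_mono)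
      \<comment> \<open>Here \<open>m = 0\<close>, since no earlier edge is required to be
        present.\<close>
      have "\<beta> + \<gamma> * real 0 \<le> real (card (B e)) * real (M - 0) / real ?N"
        using w q card_shadow_singleton[OF e, of j] finite_shadow[of "{e}" n k j] e
        unfolding well_crossed_def B_def by (metis empty_subsetI insert_subset le0 order_refl)
      also have "\<dots> \<le> real (card (B e)) * real t / real ?N"
        using t by (intro divide_right_mono mult_left_mono) auto
      finally show "exp (- (real (card (B e)) * real t / real ?N)) \<le> exp (- \<beta>)" by simp
    qed simp
    finally show "measure_pmf.prob ?p {es. Q e (take (Suc t) es)} \<le> exp (- \<beta>) / real (?N - t)" .
  qed
  finally show ?thesis by simp
qed

lemma prob_isolated_edge_between_le:
  assumes jk: "j \<le> k" and kn: "k \<le> n" and M1: "2 * M1 \<le> n choose k"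
    and w: "well_crossed n k j M \<beta> \<gamma>" and q: "2 * (k choose j) \<le> n choose j"
  shows "measure_pmf.prob (hypergraph_process k n)
      {es. \<exists>t. M \<le> t \<and> t < M1 \<and> (\<forall>J. J \<subseteq> es ! t \<and> card J = j \<longrightarrow> isolated (edges_at es t) J)}
    \<le> 2 * real M1 * exp (- \<beta>)"
proof -
  let ?p = "hypergraph_process k n" and ?N = "n choose k"
  have N0: "?N > 0" using kn by simp
  have "{es. \<exists>t. M \<le> t \<and> t < M1 \<and> P es t} = (\<Union>t\<in>{M..<M1}. {es. P es t})"
    for P :: "nat set list \<Rightarrow> nat \<Rightarrow> bool" by auto
  then have "measure_pmf.prob ?p {es. \<exists>t. M \<le> t \<and> t < M1 \<and> (\<forall>J. J \<subseteq> es ! t \<and> card J = j \<longrightarrow> isolated (edges_at es t) J)}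
    = measure_pmf.prob ?p (\<Union>t\<in>{M..<M1}. {es. \<forall>J. J \<subseteq> es ! t \<and> card J = j \<longrightarrow> isolated (edges_at es t) J})"
    by (simp only:)
  also have "\<dots> \<le> (\<Sum>t\<in>{M..<M1}. measure_pmf.prob ?p {es. \<forall>J. J \<subseteq> es ! t \<and> card J = j \<longrightarrow> isolated (edges_at es t) J})"
    by (rule prob_UN_le_sum) simp
  also have "\<dots> \<le> (\<Sum>t\<in>{M..<M1}. 2 * exp (- \<beta>))"
  proof (intro sum_mono)
    fix t assume t: "t \<in> {M..<M1}"
    have "measure_pmf.prob ?p {es. \<forall>J. J \<subseteq> es ! t \<and> card J = j \<longrightarrow> isolated (edges_at es t) J}
       \<le> real ?N * exp (- \<beta>) / real (?N - t)"
      by (rule prob_isolated_edge_at_step_le[OF jk kn _ _ w q]) (use t M1 in auto)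
    also have "\<dots> = exp (- \<beta>) * (real ?N / real (?N - t))" by simp
    also have "\<dots> \<le> exp (- \<beta>) * 2"
    proof (intro mult_left_mono)
      have "?N \<le> 2 * (?N - t)" "?N - t > 0" using t M1 N0 by auto
      then have "real ?N \<le> 2 * real (?N - t)" "0 < real (?N - t)"
        by (metis of_nat_le_iff of_nat_mult of_nat_numeral) (metis \<open>?N - t > 0\<close> of_nat_0_less_iff)
      then show "real ?N / real (?N - t) \<le> 2" by (simp only: pos_divide_le_eq)
    qed simp
    finally show "measure_pmf.prob ?p {es. \<forall>J. J \<subseteq> es ! t \<and> card J = j \<longrightarrow> isolated (edges_at es t) J} \<le> 2 * exp (- \<beta>)"
      by simp
  qed
  also have "\<dots> = real (M1 - M) * (2 * exp (- \<beta>))" by simp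
  also have "\<dots> \<le> real M1 * (2 * exp (- \<beta>))" by (intro mult_right_mono) auto
  finally show ?thesis by simp
qed


section \<open>Second moment of the number of isolated \<open>j\<close>-sets\<close>

text \<open>Two \<open>j\<close>-sets are isolated almost independently when their families of
  \<open>D\<close> supersets share at most \<open>x\<close> members. With
  \<open>d = N - D - M\<close>, the induction step compares \<open>(d - D + x) * (d + D)\<close>
  with the square of \<open>d\<close>: without \<open>x\<close> the product is smaller, and
  \<open>x\<close> adds a relative error of at most \<open>4 * x / N\<close> because
  \<open>d \<ge> N / 2\<close>.\<close>

lemma binomial_pair_le_exp:
  fixes N D x M :: nat
  assumes "2 * (M + D) \<le> N"
  shows "real ((N - 2 * D + x) choose M) * real (N choose M)
    \<le> (real ((N - D) choose M))\<^sup>2 * exp (4 * real x * real M / real N)"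
  using assms
proof (induction M)
  case (Suc M)
  have IH: "real ((N - 2 * D + x) choose M) * real (N choose M)
    \<le> (real ((N - D) choose M))\<^sup>2 * exp (4 * real x * real M / real N)" using Suc by simp
  note rec = Suc_times_binomial_Suc_real[of M]
  define d where "d = real (N - D - M)"
  have N0: "real N > 0" and d: "real N / 2 \<le> d" "0 < d" using Suc.prems by (auto simp: d_def of_nat_diff)
  have 1: "real (N - M) = d + real D" using Suc.prems by (simp add: d_def of_nat_diff)
  have 2: "real (N - 2 * D + x - M) = d - real D + real x" using Suc.prems by (simp add: d_def of_nat_diff)
  have "(d - real D + real x) * (d + real D) \<le> d\<^sup>2 + real x * (d + real D)"
    by (simp add: algebra_simps power2_eq_square)
  also have "real x * (d + real D) \<le> real x * (4 * d\<^sup>2 / real N)"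
  proof (intro mult_left_mono)
    have "(d + real D) * real N \<le> real N * real N" unfolding 1[symmetric] by (intro mult_right_mono) auto
    also have "\<dots> \<le> (2 * d) * (2 * d)" using d by (intro mult_mono) auto
    finally show "d + real D \<le> 4 * d\<^sup>2 / real N" using N0 by (simp add: field_simps power2_eq_square)
  qed simp
  also have "d\<^sup>2 + real x * (4 * d\<^sup>2 / real N) = d\<^sup>2 * (1 + 4 * real x / real N)" by (simp add: algebra_simps)
  also have "\<dots> \<le> d\<^sup>2 * exp (4 * real x / real N)" by (intro mult_left_mono exp_ge_add_one_self) auto
  finally have 3: "(d - real D + real x) * (d + real D) \<le> d\<^sup>2 * exp (4 * real x / real N)" by simp
  have nonneg: "0 \<le> (d - real D + real x) * (d + real D)" unfolding 1[symmetric] 2[symmetric] by simp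
  have "(real (Suc M) * real ((N - 2 * D + x) choose Suc M)) * (real (Suc M) * real (N choose Suc M))
    = (real ((N - 2 * D + x) choose M) * real (N choose M)) * ((d - real D + real x) * (d + real D))"
    unfolding rec 1 2 by (simp only: mult_ac)
  also have "\<dots> \<le> ((real ((N - D) choose M))\<^sup>2 * exp (4 * real x * real M / real N)) * (d\<^sup>2 * exp (4 * real x / real N))"
    by (intro mult_mono IH 3 nonneg) auto
  also have "\<dots> = (real ((N - D) choose M) * d)\<^sup>2 * (exp (4 * real x * real M / real N) * exp (4 * real x / real N))"
    by (simp only: power_mult_distrib mult_ac)
  also have "real ((N - D) choose M) * d = real (Suc M) * real ((N - D) choose Suc M)"
    by (simp only: rec d_def)
  also have "exp (4 * real x * real M / real N) * exp (4 * real x / real N) = exp (4 * real x * real (Suc M) / real N)"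
    by (simp add: exp_add[symmetric] add_divide_distrib[symmetric] algebra_simps)
  finally have "(real (Suc M))\<^sup>2 * (real ((N - 2 * D + x) choose Suc M) * real (N choose Suc M))
    \<le> (real (Suc M))\<^sup>2 * ((real ((N - D) choose Suc M))\<^sup>2 * exp (4 * real x * real (Suc M) / real N))"
    by (simp only: power_mult_distrib power2_eq_square mult_ac)
  then show ?case by (simp add: mult_le_cancel_left_pos del: of_nat_Suc binomial_Suc_Suc)
qed simp

text \<open>A converse to the exponential upper bound for missing \<open>D\<close> points. Each step
  contributes a factor \<open>1 - y\<close> with small \<open>y = D / (N - M)\<close>, and the
  logarithm of this factor is at least \<open>- y - 2 * y\<^sup>2\<close>.\<close>

lemma binomial_diff_ge_exp:
  fixes N D M :: nat
  assumes "6 * M \<le> N" "20 * D \<le> N"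
  shows "real (N choose M) * exp (- (3 / 2 * real D * real M / real N)) \<le> real ((N - D) choose M)"
  using assms
proof (induction M)
  case (Suc M)
  note rec = Suc_times_binomial_Suc_real[of M]
  have N0: "real N > 0" "real (N - M) > 0" using Suc.prems by auto
  define y where "y = real D / real (N - M)"
  have y5: "real (N - M) * 6 \<ge> real N * 5" using Suc.prems by (simp add: of_nat_diff)
  have y1: "y * 5 \<le> 6 * (real D / real N)"
  proof -
    have "real D * (real N * 5) \<le> real D * (real (N - M) * 6)" by (intro mult_left_mono y5) auto
    then show ?thesis unfolding y_def using N0 by (simp add: field_simps del: of_nat_diff)
  qed
  have "real D / real N \<le> 1 / 20" using Suc.prems N0 by (simp add: field_simps)
  then have y2: "y \<le> 1/16" "0 \<le> y" using y1 by (auto simp: y_def)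
  \<comment> \<open>This gives \<open>y + 2 * y\<^sup>2 \<le> 9/8 * y\<close>; together with
    \<open>y \<le> 6/5 * D / N\<close> the constant is \<open>27/20\<close>, below
    \<open>3/2\<close>.\<close>
  have "y * y \<le> y * (1/16)" using y2 by (intro mult_left_mono)
  then have "y + 2 * y\<^sup>2 \<le> 3/2 * (real D / real N)" using y1 y2 by (simp add: power2_eq_square)
  moreover have "- y - 2 * y\<^sup>2 \<le> ln (1 - y)" using ln_one_minus_pos_lower_bound[of y] y2 by simp
  ultimately have "- (3/2 * (real D / real N)) \<le> ln (1 - y)" by linarith
  then have e: "exp (- (3/2 * (real D / real N))) \<le> 1 - y"
    using y2 by (metis exp_le_cancel_iff exp_ln diff_gt_0_iff_gt less_1_mult order_le_less_trans[of y "1/16" 1] one_less_numeral_iff divide_less_eq_1 semiring_norm(76) zero_less_numeral mult_1)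
  have "real (N - M) * exp (- (3/2 * (real D / real N))) \<le> real (N - M) * (1 - y)"
    by (intro mult_left_mono e) auto
  also have "\<dots> = real (N - M) - real D" using N0 by (simp add: y_def right_diff_distrib)
  also have "\<dots> = real (N - D - M)" using Suc.prems by (simp add: of_nat_diff)
  finally have s: "real (N - M) * exp (- (3/2 * (real D / real N))) \<le> real (N - D - M)" .
  have "real (Suc M) * (real (N choose Suc M) * exp (- (3 / 2 * real D * real (Suc M) / real N)))
    = (real (N choose M) * exp (- (3 / 2 * real D * real M / real N))) * (real (N - M) * exp (- (3/2 * (real D / real N))))"
  proof -
    have "exp (- (3 / 2 * real D * real (Suc M) / real N)) = exp (- (3 / 2 * real D * real M / real N)) * exp (- (3/2 * (real D / real N)))"
    proof -
      have "3 / 2 * real D * real (Suc M) / real N = 3 / 2 * real D * real M / real N + 3/2 * (real D / real N)"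
        by (simp add: algebra_simps add_divide_distrib)
      then show ?thesis by (simp only: minus_add_distrib exp_add)
    qed
    then show ?thesis by (simp only: mult.assoc[symmetric] rec) (simp only: mult_ac)
  qed
  also have "\<dots> \<le> real ((N - D) choose M) * real (N - D - M)"
    using Suc by (intro mult_mono s) auto
  also have "\<dots> = real (Suc M) * real ((N - D) choose Suc M)" by (simp only: rec)
  finally show ?case by (simp add: mult_le_cancel_left_pos del: of_nat_Suc binomial_Suc_Suc)
qed simp

text \<open>Chebyshev's inequality for the number \<open>X\<close> of isolated
  \<open>j\<close>-sets: \<open>X = 0\<close> is a deviation by the full mean \<mu>. The diagonal of
  the second moment gives \<open>1 / \<mu>\<close>, and the dependence between different
  \<open>j\<close>-sets gives \<open>\<rho> - 1\<close>.\<close>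

lemma prob_no_isolated_le:
  assumes jk: "j < k" and kn: "k \<le> n"
    and D: "D = (n - j) choose (k - j)" and N: "N = n choose k"
    and M: "6 * M \<le> N" "20 * D \<le> N"
  shows "measure_pmf.prob (hypergraph_process k n) {es. \<forall>J\<in>sets_of_size n j. \<not> isolated (edges_at es M) J}
    \<le> 1 / (real (n choose j) * exp (- (3 / 2 * real D * real M / real N)))
      + (exp (4 * real ((n - Suc j) choose (k - Suc j)) * real M / real N) - 1)"
proof -
  let ?J = "sets_of_size n j" and ?T = "n choose j" and ?D' = "(n - Suc j) choose (k - Suc j)"
  define p where "p = hypergraph_process k n"
  define U where "U J = {e \<in> sets_of_size n k. J \<subseteq> e}" for J
  have MN: "M \<le> N" using M by simp
  have N0: "N > 0" using N kn by simp
  have T0: "?T > 0" using jk kn by simp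
  define I where "I J es = (if isolated (edges_at es M) J then 1 else 0 :: real)" for J es
  define X where "X es = (\<Sum>J\<in>?J. I J es)" for es
  define \<pi> where "\<pi> = real ((N - D) choose M) / real (N choose M)"
  define \<rho> where "\<rho> = exp (4 * real ?D' * real M / real N)"
  have fs: "finite (set_pmf p)"
    unfolding p_def hypergraph_process_def using set_pmf_first_edges[of N n k] N by simp
  have int: "integrable (measure_pmf p) f" for f :: "nat set list \<Rightarrow> real"
    by (rule integrable_measure_pmf_finite[OF fs])
  have avoid: "measure_pmf.prob p {es. B \<inter> edges_at es M = {}} = real ((N - card B) choose M) / real (N choose M)"
    if "B \<subseteq> sets_of_size n k" for B
    using prob_hypergraph_process_take[of M n k "\<lambda>es. {} \<subseteq> set es \<and> B \<inter> set es = {}"]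
      prob_distinct_lists_between[of "sets_of_size n k" "{}" B M] that MN N
    by (simp add: p_def edges_at_def)
  have cU: "card (U J) = D" if "J \<in> ?J" for J
    using that card_sets_of_size_superset[of J n k] jk by (auto simp: U_def sets_of_size_def D)
  have iso_iff: "isolated (edges_at es M) J \<longleftrightarrow> U J \<inter> edges_at es M = {}" if "es \<in> set_pmf p" for es J
  proof -
    have "edges_at es M \<subseteq> sets_of_size n k"
      using that set_pmf_first_edges[of N n k] N set_take_subset[of M es]
      by (auto simp: p_def hypergraph_process_def distinct_lists_def edges_at_def)
    then show ?thesis by (auto simp: isolated_def U_def)
  qed
  have EI2: "measure_pmf.expectation p (\<lambda>es. I J es * I J' es) = real ((N - card (U J \<union> U J')) choose M) / real (N choose M)" for J J'
  proof -
    have "measure_pmf.expectation p (\<lambda>es. I J es * I J' es) = measure_pmf.expectation p (indicator {es. (U J \<union> U J') \<inter> edges_at es M = {}})"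
    proof (intro integral_cong_AE AE_pmfI)
      fix es assume "es \<in> set_pmf p"
      then show "I J es * I J' es = indicator {es. (U J \<union> U J') \<inter> edges_at es M = {}} es"
        using iso_iff[of es J] iso_iff[of es J'] by (auto simp: I_def indicator_def Int_Un_distrib2)
    qed auto
    also have "\<dots> = measure_pmf.prob p {es. (U J \<union> U J') \<inter> edges_at es M = {}}" by simp
    also have "\<dots> = real ((N - card (U J \<union> U J')) choose M) / real (N choose M)"
      by (rule avoid) (auto simp: U_def)
    finally show ?thesis .
  qed
  have II: "I J es * I J es = I J es" for J es by (simp add: I_def)
  have EI: "measure_pmf.expectation p (I J) = \<pi>" if "J \<in> ?J" for J
    using EI2[of J J] cU[OF that] by (simp add: II \<pi>_def)
  have \<mu>: "measure_pmf.expectation p X = real ?T * \<pi>"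
    unfolding X_def by (subst Bochner_Integration.integral_sum) (auto simp: int EI)
  have pair: "measure_pmf.expectation p (\<lambda>es. I J es * I J' es) \<le> \<pi>\<^sup>2 * \<rho>" if J: "J \<in> ?J" "J' \<in> ?J" "J \<noteq> J'" for J J'
  proof -
    have "card (U J \<inter> U J') \<le> ?D'" unfolding U_def using J jk by (rule card_superset_both_le)
    moreover have "card (U J) + card (U J') = card (U J \<union> U J') + card (U J \<inter> U J')"
      by (rule card_Un_Int) (auto simp: U_def)
    ultimately have b: "N - card (U J \<union> U J') \<le> N - 2 * D + ?D'" using cU J by simp
    have "real ((N - card (U J \<union> U J')) choose M) \<le> real ((N - 2 * D + ?D') choose M)"
      using b by (simp add: binomial_right_mono)
    then have "real ((N - card (U J \<union> U J')) choose M) * real (N choose M) \<le> real ((N - 2 * D + ?D') choose M) * real (N choose M)"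
      by (intro mult_right_mono) auto
    also have "\<dots> \<le> (real ((N - D) choose M))\<^sup>2 * \<rho>"
      unfolding \<rho>_def by (rule binomial_pair_le_exp) (use M in simp)
    finally show ?thesis unfolding EI2 \<pi>_def using MN
      by (simp add: field_simps power2_eq_square)
  qed
  have \<pi>0: "\<pi> > 0" unfolding \<pi>_def using M by simp
  have \<rho>1: "\<rho> > 0" by (simp add: \<rho>_def)
  have "measure_pmf.expectation p (\<lambda>es. (X es)\<^sup>2) = (\<Sum>J\<in>?J. \<Sum>J'\<in>?J. measure_pmf.expectation p (\<lambda>es. I J es * I J' es))"
    unfolding X_def power2_eq_square sum_product
    by (simp add: Bochner_Integration.integral_sum int)
  \<comment> \<open>The pair bound is added on the diagonal as well, which only enlarges the sum and
    makes it factor.\<close>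
  also have "\<dots> \<le> (\<Sum>J\<in>?J. \<Sum>J'\<in>?J. (if J' = J then \<pi> else 0) + \<pi>\<^sup>2 * \<rho>)"
  proof (intro sum_mono)
    fix J J' assume "J \<in> ?J" "J' \<in> ?J"
    then show "measure_pmf.expectation p (\<lambda>es. I J es * I J' es) \<le> (if J' = J then \<pi> else 0) + \<pi>\<^sup>2 * \<rho>"
      using pair[of J J'] EI[of J] \<rho>1 by (auto simp: II)
  qed
  also have "\<dots> = real ?T * \<pi> + (real ?T * \<pi>)\<^sup>2 * \<rho>"
    by (simp add: sum.distrib power_mult_distrib power2_eq_square algebra_simps)
  finally have EX2: "measure_pmf.expectation p (\<lambda>es. (X es)\<^sup>2) \<le> real ?T * \<pi> + (real ?T * \<pi>)\<^sup>2 * \<rho>" .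
  define \<mu> where "\<mu> = real ?T * \<pi>"
  have \<mu>0: "\<mu> > 0" using T0 \<pi>0 by (simp add: \<mu>_def)
  have "measure_pmf.prob p {es. \<forall>J\<in>?J. \<not> isolated (edges_at es M) J} \<le> measure_pmf.prob p {es \<in> space p. \<mu> \<le> \<bar>X es - measure_pmf.expectation p X\<bar>}"
    using \<mu> \<mu>0 by (intro measure_pmf.finite_measure_mono) (auto simp: X_def I_def \<mu>_def)
  also have "\<dots> \<le> measure_pmf.variance p X / \<mu>\<^sup>2"
    by (rule measure_pmf.Chebyshev_inequality) (use \<mu>0 int in auto)
  also have "measure_pmf.variance p X = measure_pmf.expectation p (\<lambda>es. (X es)\<^sup>2) - \<mu>\<^sup>2"
    using measure_pmf.variance_eq[of p X] int \<mu> by (simp add: \<mu>_def)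
  also have "\<dots> / \<mu>\<^sup>2 \<le> (\<mu> + \<mu>\<^sup>2 * \<rho> - \<mu>\<^sup>2) / \<mu>\<^sup>2"
    using EX2 by (intro divide_right_mono) (auto simp: \<mu>_def)
  also have "\<dots> = 1 / \<mu> + (\<rho> - 1)" using \<mu>0 by (simp add: field_simps power2_eq_square)
  also have "1 / \<mu> \<le> 1 / (real ?T * exp (- (3 / 2 * real D * real M / real N)))"
  proof -
    have "exp (- (3 / 2 * real D * real M / real N)) \<le> \<pi>"
      unfolding \<pi>_def using binomial_diff_ge_exp[OF M] MN by (simp add: field_simps)
    then have "real ?T * exp (- (3 / 2 * real D * real M / real N)) \<le> \<mu>"
      unfolding \<mu>_def by (intro mult_left_mono) auto
    then show ?thesis using T0 \<mu>0 by (intro divide_left_mono mult_pos_pos) auto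
  qed
  finally show ?thesis by (simp add: \<rho>_def p_def)
qed

section \<open>Asymptotics\<close>

lemma le_binomial:
  assumes "1 \<le> j" "j < k"
  shows "k \<le> k choose j"
  using assms
proof (induction k)
  case (Suc k)
  show ?case
  proof (cases "j = k")
    case False
    then have "k \<le> k choose j" "0 < k choose (j - 1)" using Suc by auto
    moreover have "Suc k choose j = (k choose (j - 1)) + (k choose j)"
      using Suc.prems(1) by (cases j) auto
    ultimately show ?thesis by linarith
  qed simp
qed simp

text \<open>The first identity counts pairs of a \<open>k\<close>-set and a \<open>j\<close>-subset
  of it. The second shows that the codegree of two \<open>j\<close>-sets is smaller than the degree
  by a factor of order \<open>n\<close>.\<close>

lemma binomial_degree_identities:
  assumes "j < k" "k \<le> n"
  shows "real (n choose k) * real (k choose j) = real (n choose j) * real ((n - j) choose (k - j))"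
    and "(real n - real j) * real ((n - Suc j) choose (k - Suc j)) = (real k - real j) * real ((n - j) choose (k - j))"
proof -
  show "real (n choose k) * real (k choose j) = real (n choose j) * real ((n - j) choose (k - j))"
    using choose_mult[of j k n] assms by (metis less_imp_le of_nat_mult)
  have "(k - j) * ((n - j) choose (k - j)) = (n - j) * ((n - j - 1) choose (k - j - 1))"
    using assms by (intro times_binomial_minus1_eq) auto
  then have "(n - j) * ((n - Suc j) choose (k - Suc j)) = (k - j) * ((n - j) choose (k - j))" by simp
  then have "real (n - j) * real ((n - Suc j) choose (k - Suc j)) = real (k - j) * real ((n - j) choose (k - j))"
    by (metis of_nat_mult)
  then show "(real n - real j) * real ((n - Suc j) choose (k - Suc j)) = (real k - real j) * real ((n - j) choose (k - j))"
    using assms by (simp add: of_nat_diff)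
qed

text \<open>For small \<open>s = card S\<close> there are almost \<open>s * D\<close> crossing
  \<open>k\<close>-sets, and the exponent is close to \<open>s * j * L / 2\<close>. For large
  \<open>s\<close> isoperimetry gives \<open>s * L / (8 * q)\<close>: one half covers the term in
  \<open>m \<le> s\<close>, the other half the constant term.\<close>

lemma well_crossed_explicit:
  fixes L :: real
  assumes j: "1 \<le> j" "j < k" and kn: "k \<le> n" and L: "0 < L"
    and q: "q = k choose j" "3 \<le> q" and T: "T = n choose j" "2 \<le> T"
    and h1: "4 * real q \<le> real j * L"
    and h3: "100 * (18 * real q * real j) * (real k - real j) \<le> real n - real j"
    and h4: "100 * real q * (1 + 18 * real q * real j) \<le> real j * L * real T"
    and M: "real j * L * real T / (2 * real q) - 1 \<le> real M"
  shows "well_crossed n k j M (11 / 10 * real j * L) (L / (16 * real q))"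
  unfolding well_crossed_def
proof (intro allI impI, elim conjE)
  fix S m assume S: "S \<subseteq> sets_of_size n j" and qs: "k choose j \<le> card S" and sT: "2 * card S \<le> n choose j"
    and m: "m \<le> card S"
  define N where "N = n choose k"
  define D where "D = (n - j) choose (k - j)"
  define D' where "D' = (n - Suc j) choose (k - Suc j)"
  define c where "c = real (card (crossing n k j S))"
  define s where "s = real (card S)"
  have T0: "real T > 0" and N0: "real N > 0" and D0: "real D > 0" and q0: "real q > 0" and nj: "real n - real j > 0"
    and j0: "real j \<ge> 1"
    using T q j kn by (auto simp: N_def D_def)
  have NqTD: "real N * real q = real T * real D"
    unfolding N_def q(1) T D_def by (rule binomial_degree_identities(1)[OF j(2) kn])
  have D': "(real n - real j) * real D' = (real k - real j) * real D"
    unfolding D_def D'_def by (rule binomial_degree_identities(2)[OF j(2) kn])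
  have s3: "3 \<le> s" using qs q by (simp add: s_def)
  have ms: "real m \<le> s" using m by (simp add: s_def)
  have sT': "2 * s \<le> real T" using sT T by (simp add: s_def)
  have "4 * real q * real T \<le> real j * L * real T" using h1 by (intro mult_right_mono) auto
  then have jLT: "2 * real T \<le> real j * L * real T / (2 * real q)" using q0 by (simp add: field_simps)
  have mM: "real (M - m) = real M - real m"
  proof -
    have "real m \<le> real M" using M jLT T0 ms sT' T(2) by linarith
    then show ?thesis by simp
  qed
  have "11 / 10 * real j * L + L / (16 * real q) * real m \<le> c * (real M - real m) / real N"
  \<comment> \<open>Above this threshold \<open>L / (16 * q) * s\<close> is at least
    \<open>18/16 * j * L\<close>, which exceeds \<open>11/10 * j * L\<close>.\<close>
  proof (cases "s \<le> 18 * real q * real j")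
    case True
    define r where "r = (real k - real j) / (real n - real j)"
    have D'r: "real D' = r * real D" using D' nj by (simp add: r_def field_simps)
    have r0: "0 \<le> r" using j nj by (simp add: r_def)
    have "s * r \<le> (18 * real q * real j) * r" using True r0 by (intro mult_right_mono)
    also have "\<dots> \<le> 1 / 100" using h3 nj by (simp add: r_def field_simps)
    finally have sr: "s * r \<le> 1 / 100" .
    have "99 / 100 * s * real D \<le> s * (1 - s * r) * real D"
      using sr s3 D0 by (intro mult_right_mono) (auto intro: mult_left_mono simp: mult.commute[of "99/100"])
    also have "\<dots> = s * (real D - s * real D')" by (simp add: D'r algebra_simps)
    also have "\<dots> \<le> c"
      using crossing_ge_small[OF j kn S] by (simp add: s_def D_def D'_def c_def)
    finally have c: "99 / 100 * s * real D \<le> c" .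
    \<comment> \<open>\<open>h4\<close> bounds the loss from rounding and from \<open>m\<close> by
      \<open>1/100 * j * L * T\<close>, so \<open>1/2\<close> drops to
      \<open>49/100\<close>.\<close>
    have qM: "49 / 100 * real j * L * real T \<le> real q * (real M - real m)"
    proof -
      have "real q * (real j * L * real T / (2 * real q) - 1 - 18 * real q * real j) \<le> real q * (real M - real m)"
        using M ms True by (intro mult_left_mono) auto
      moreover have "real q * (real j * L * real T / (2 * real q) - 1 - 18 * real q * real j)
         = real j * L * real T / 2 - real q * (1 + 18 * real q * real j)" using q0 by (simp add: field_simps)
      ultimately show ?thesis using h4 by linarith
    qed
    have "(99 / 100 * s * real D) * (49 / 100 * real j * L * real T) \<le> c * (real q * (real M - real m))"
      by (rule mult_mono[OF c qM]) (use L in \<open>auto simp: c_def\<close>)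
    then have "(99 / 100 * s * (49 / 100 * real j * L)) * (real T * real D) \<le> real q * (c * (real M - real m))"
      by (simp only: mult_ac)
    then have "real q * ((99 / 100 * s * (49 / 100 * real j * L)) * real N) \<le> real q * (c * (real M - real m))"
      unfolding NqTD[symmetric] by (simp only: mult_ac)
    then have "99 / 100 * s * (49 / 100 * real j * L) * real N \<le> c * (real M - real m)"
      using q0 by (simp only: mult_le_cancel_left_pos)
    then have main: "99 / 100 * s * (49 / 100 * real j * L) \<le> c * (real M - real m) / real N"
      using N0 by (simp only: pos_le_divide_eq)
    \<comment> \<open>The term in \<open>m\<close> thus takes at most \<open>1/48\<close> of
      \<open>s * j * L\<close>, while \<open>main\<close> provides \<open>4851/10000\<close> of it.
      Since \<open>s \<ge> 3\<close>, the difference exceeds \<open>11/10 * j * L\<close>.\<close>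
    have "L / (16 * real q) * real m \<le> (L / 48) * s"
      using L q(2) q0 ms by (intro mult_mono divide_left_mono) auto
    also have "\<dots> \<le> (L / 48) * s * real j" using L s3 j0 by simp
    finally have "L / (16 * real q) * real m \<le> s * (real j * L) / 48" by (simp add: field_simps)
    moreover have "3 * (real j * L) \<le> s * (real j * L)" using s3 j0 L by (intro mult_right_mono) auto
    moreover have "0 \<le> real j * L" using L by simp
    moreover have "99 / 100 * s * (49 / 100 * real j * L) = 4851 / 10000 * (s * (real j * L))" by simp
    ultimately show ?thesis using main by linarith
  next
    case False
    have sN: "s * real N \<le> 2 * real j * real T * c"
      using crossing_ge_isoperimetric[OF j(2) kn S sT] by (simp add: s_def N_def c_def T)
    \<comment> \<open>By \<open>jLT\<close>, \<open>j * L * T / (4 * q)\<close> is at least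
      \<open>T\<close>, which covers both the rounding loss 1 and
      \<open>m \<le> T / 2\<close>.\<close>
    have MM: "real j * L * real T / (4 * real q) \<le> real M - real m"
    proof -
      have "real j * L * real T / (2 * real q) = 2 * (real j * L * real T / (4 * real q))" by simp
      then show ?thesis using jLT M ms sT' T(2) by linarith
    qed
    have "(s * real N) * (real j * L * real T / (4 * real q)) \<le> (2 * real j * real T * c) * (real M - real m)"
      by (rule mult_mono[OF sN MM]) (use L in \<open>auto simp: c_def\<close>)
    then have "(2 * real j * real T) * (s * L / (8 * real q) * real N) \<le> (2 * real j * real T) * (c * (real M - real m))"
      by (simp add: field_simps)
    then have "s * L / (8 * real q) * real N \<le> c * (real M - real m)"
      by (rule mult_left_le_imp_le) (use j0 T0 in simp)
    then have main: "s * L / (8 * real q) \<le> c * (real M - real m) / real N"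
      using N0 by (simp only: pos_le_divide_eq)
    have "L / (16 * real q) * real m \<le> L / (16 * real q) * s" using L ms by (intro mult_left_mono) auto
    moreover have "L / (16 * real q) * (18 * real q * real j) \<le> L / (16 * real q) * s"
      using False L by (intro mult_left_mono) auto
    moreover have "L / (16 * real q) * (18 * real q * real j) = 18 / 16 * (real j * L)" using q0 by simp
    moreover have "s * L / (8 * real q) = 2 * (L / (16 * real q) * s)" by simp
    moreover have "0 \<le> real j * L" using L by simp
    ultimately show ?thesis using main by linarith
  qed
  then show "11 / 10 * real j * L + L / (16 * real q) * real m
    \<le> real (card (crossing n k j S)) * real (M - m) / real (n choose k)"
    by (simp add: mM c_def N_def)
qed

text \<open>Union bound over four failures: no isolated \<open>j\<close>-set left at
  \<open>M0\<close> (\<open>E1\<close>), some left at \<open>M1\<close> (\<open>E2\<close>), a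
  second component at \<open>M0\<close> (\<open>E3\<close>), an edge on isolated
  \<open>j\<close>-sets in between (\<open>E4\<close>).\<close>

lemma prob_hitting_times_ne_le:
  fixes L :: real
  assumes j: "1 \<le> j" "j < k" and kn: "k \<le> n" and L: "L = ln (real n)" "0 < L"
    and q: "q = k choose j" "3 \<le> q" and T: "T = n choose j"
    and h1: "4 * real q \<le> real j * L"
    and h3: "100 * (18 * real q * real j) * (real k - real j) \<le> real n - real j"
    and h4: "100 * real q * (1 + 18 * real q * real j) \<le> real j * L * real T"
    and h5: "20 * real q \<le> real T"
    and h6: "6 * real j * L * (real k - real j) \<le> real n - real j"
    and h7: "2 * real q * real j * L * exp (- (L / (16 * real q))) \<le> 1"
  shows "measure_pmf.prob (hypergraph_process k n) {es. tau_C n j es \<noteq> tau_I n j es}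
    \<le> exp (- real j * L) + 12 * real j * L * exp (- (real j * L / 10)) + real j ^ j * exp (- (real j * L / 4))
      + (exp (2 * (real k - real j) * real j * L / (real n - real j)) - 1)"
proof -
  let ?p = "hypergraph_process k n"
  define N where "N = n choose k"
  define D where "D = (n - j) choose (k - j)"
  define D' where "D' = (n - Suc j) choose (k - Suc j)"
  \<comment> \<open>Since \<open>D / N = q / T\<close>, this choice makes
    \<open>D * x / N = j * L\<close>: the estimated number of isolated \<open>j\<close>-sets at step
    \<open>x\<close>, \<open>T * exp (- D * x / N)\<close>, is of constant order.\<close>
  define x where "x = real j * L * real T / real q"
  define M0 where "M0 = nat \<lfloor>x / 2\<rfloor>"
  define M1 where "M1 = nat \<lceil>2 * x\<rceil>"
  have T0: "real T > 0" and N0: "real N > 0" and D0: "real D > 0" and q0: "real q > 0" and nj: "real n - real j > 0"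
    and j0: "real j \<ge> 1" and n0: "real n > 0"
    using T q j kn by (auto simp: N_def D_def)
  have NqTD: "real N * real q = real T * real D"
    unfolding N_def q(1) T D_def by (rule binomial_degree_identities(1)[OF j(2) kn])
  have D': "(real n - real j) * real D' = (real k - real j) * real D"
    unfolding D_def D'_def by (rule binomial_degree_identities(2)[OF j(2) kn])
  have Dge: "real n - real j \<le> (real k - real j) * real D"
  proof -
    have "1 * (real n - real j) \<le> real D' * (real n - real j)"
      using nj j kn by (intro mult_right_mono) (auto simp: D'_def Suc_le_eq)
    then show ?thesis using D' by (simp add: mult.commute)
  qed
  have Tle: "real T \<le> exp (real j * L)"
  proof -
    have "real T \<le> real n ^ j" using binomial_le_pow[of j n] j kn T by (metis less_imp_le of_nat_le_iff of_nat_power order_trans)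
    also have "\<dots> = exp (real j * L)" using n0 by (simp add: L exp_of_nat_mult)
    finally show ?thesis .
  qed
  have Tge: "exp (real j * L) \<le> real j ^ j * real T"
  proof -
    have "(real n / real j) ^ j \<le> real T" using binomial_ge_n_over_k_pow_k[of j n, where 'a = real] j kn T by simp
    then have "real n ^ j \<le> real j ^ j * real T" using j0 by (simp add: power_divide field_simps)
    then show ?thesis using n0 by (simp add: L exp_of_nat_mult)
  qed
  have x1: "4 * real T \<le> x"
  proof -
    have "4 * real q * real T \<le> real j * L * real T" using h1 by (intro mult_right_mono) auto
    then show ?thesis using q0 by (simp add: x_def field_simps)
  qed
  have T20: "60 \<le> real T" using h5 q(2) by linarith
  have M0: "real M0 \<le> x / 2" "x / 2 - 1 \<le> real M0" using x1 T0 by (auto simp: M0_def) linarith+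
  have M1: "2 * x \<le> real M1" "real M1 \<le> 2 * x + 1" using x1 T0 by (auto simp: M1_def)
  have xN: "6 * x \<le> real N"
  proof -
    have "(real k - real j) * (6 * real j * L) \<le> (real k - real j) * real D" using Dge h6 by (simp add: mult.commute)
    then have "6 * real j * L \<le> real D" using j by simp
    then have "real T * (6 * real j * L) \<le> real T * real D" using T0 by (intro mult_left_mono) auto
    then have "real T * (6 * real j * L) \<le> real N * real q" by (simp add: NqTD)
    then show ?thesis using q0 by (simp add: x_def field_simps)
  qed
  have c1: "2 * M1 \<le> N" using xN M1 x1 T20 by linarith
  have c2: "6 * M0 \<le> N" using xN M0 x1 T20 by linarith
  have c3: "20 * D \<le> N"
  proof -
    have "real D * (20 * real q) \<le> real D * real T" using h5 by (intro mult_left_mono) auto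
    then have "20 * real D * real q \<le> real N * real q" using NqTD by (simp add: mult_ac)
    then have "20 * real D \<le> real N" using q0 by simp
    then show ?thesis by linarith
  qed
  have c4: "T \<le> 2 * M0" using M0 x1 T20 by linarith
  have c5: "2 * q \<le> T" using h5 by linarith
  have c6: "M0 \<le> M1" using M0 M1 x1 T20 by linarith
  have DN: "real D / real N = real q / real T" using NqTD N0 T0 by (simp add: field_simps)
  have DM0: "real D * real M0 / real N \<le> real j * L / 2"
  proof -
    have "real D * real M0 / real N = real q / real T * real M0" unfolding DN[symmetric] by simp
    also have "\<dots> \<le> real q / real T * (x / 2)" using M0 by (intro mult_left_mono) auto
    also have "\<dots> = real j * L / 2" using q0 T0 by (simp add: x_def)
    finally show ?thesis .
  qed
  have DM1: "2 * real j * L \<le> real D * real M1 / real N"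
  proof -
    have "2 * real j * L = real q / real T * (2 * x)" using q0 T0 by (simp add: x_def)
    also have "\<dots> \<le> real q / real T * real M1" using M1 by (intro mult_left_mono) auto
    also have "\<dots> = real D * real M1 / real N" unfolding DN[symmetric] by simp
    finally show ?thesis .
  qed
  define \<beta> where "\<beta> = 11 / 10 * real j * L"
  have w: "well_crossed n k j M0 \<beta> (L / (16 * real q))"
    unfolding \<beta>_def
    by (rule well_crossed_explicit[OF j kn L(2) q T _ h1 h3 h4]) (use T20 M0 in \<open>auto simp: x_def mult.commute\<close>)
  define E1 where "E1 = {es. \<forall>J\<in>sets_of_size n j. \<not> isolated (edges_at es M0) J}"
  define E2 where "E2 = {es. \<exists>J\<in>sets_of_size n j. isolated (edges_at es M1) J}"
  define E3 where "E3 = {es. \<exists>e\<in>sets_of_size n k. \<exists>C. grown (overlap j) {e} C \<and> separated n k j (edges_at es M0) C}"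
  define E4 where "E4 = {es. \<exists>t. M0 \<le> t \<and> t < M1 \<and> (\<forall>J. J \<subseteq> es ! t \<and> card J = j \<longrightarrow> isolated (edges_at es t) J)}"
  have P1: "measure_pmf.prob ?p E1 \<le> real j ^ j * exp (- (real j * L / 4))
      + (exp (2 * (real k - real j) * real j * L / (real n - real j)) - 1)"
  proof -
    have "measure_pmf.prob ?p E1 \<le> 1 / (real T * exp (- (3 / 2 * real D * real M0 / real N))) + (exp (4 * real D' * real M0 / real N) - 1)"
      unfolding E1_def T D'_def by (rule prob_no_isolated_le[OF j(2) kn D_def N_def c2 c3])
    also have "1 / (real T * exp (- (3 / 2 * real D * real M0 / real N))) \<le> real j ^ j * exp (- (real j * L / 4))"
    proof -
      \<comment> \<open>By \<open>DM0\<close> the exponent is at most \<open>3/4 * j * L\<close>, so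
        the lower bound on the mean is at least \<open>exp (j * L / 4) / j ^ j\<close>.\<close>
      have "exp (real j * L / 4) * exp (3 / 2 * real D * real M0 / real N) \<le> exp (real j * L)"
        unfolding exp_add[symmetric] using DM0 by simp
      also note Tge
      finally have "exp (real j * L / 4) * exp (3 / 2 * real D * real M0 / real N) \<le> real j ^ j * real T" .
      then show ?thesis using T0 by (simp add: exp_minus field_simps)
    qed
    also have "4 * real D' * real M0 / real N \<le> 2 * (real k - real j) * real j * L / (real n - real j)"
    proof -
      have "real D' = (real k - real j) / (real n - real j) * real D" using D' nj by (simp add: field_simps)
      then have "4 * real D' * real M0 / real N = 4 * ((real k - real j) / (real n - real j)) * (real D * real M0 / real N)"
        by simp
      also have "\<dots> \<le> 4 * ((real k - real j) / (real n - real j)) * (real j * L / 2)"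
        using j nj by (intro mult_left_mono DM0) auto
      also have "4 * (a / b) * (c / 2) = 2 * a * c / b" for a b c :: real by simp
      finally show ?thesis by (simp only: mult.assoc)
    qed
    finally show ?thesis by simp
  qed
  have P2: "measure_pmf.prob ?p E2 \<le> exp (- real j * L)"
  proof -
    have "measure_pmf.prob ?p E2 \<le> real T * exp (- (real D * real M1 / real N))"
      unfolding E2_def T D_def N_def by (rule prob_exists_isolated_le) (use j c1 in \<open>auto simp: N_def\<close>)
    also have "\<dots> \<le> exp (real j * L) * exp (- (2 * real j * L))" using Tle DM1 by (intro mult_mono) auto
    also have "\<dots> = exp (- real j * L)" by (simp add: exp_add[symmetric])
    finally show ?thesis .
  qed
  \<comment> \<open>Used for \<open>M0\<close> and \<open>M1\<close>. The number of steps is of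
    order at most \<open>L * exp (j * L)\<close>, and \<beta> exceeds \<open>j * L\<close> by
    \<open>j * L / 10\<close>, which is what remains.\<close>
  have P34: "real M \<le> 3 * x \<Longrightarrow> 2 * real M * exp (- \<beta>) \<le> 6 * real j * L * exp (- (real j * L / 10))" for M
  proof -
    assume "real M \<le> 3 * x"
    also have "x \<le> real j * L * real T"
    proof -
      have "0 \<le> real j * L * real T" "1 \<le> real q" using L q by auto
      then show ?thesis unfolding x_def using mult_left_mono[of 1 "real q" "real j * L * real T"]
        by (simp add: divide_le_eq)
    qed
    also have "\<dots> \<le> real j * L * exp (real j * L)" using L Tle by (intro mult_left_mono) auto
    finally have "real M \<le> 3 * (real j * L * exp (real j * L))" by simp
    then have "2 * real M * exp (- \<beta>) \<le> 2 * (3 * (real j * L * exp (real j * L))) * exp (- \<beta>)"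
      by (intro mult_right_mono mult_left_mono) auto
    also have "\<dots> = 6 * real j * L * (exp (real j * L) * exp (- \<beta>))" by simp
    also have "exp (real j * L) * exp (- \<beta>) = exp (- (real j * L / 10))"
      unfolding exp_add[symmetric] \<beta>_def by (rule arg_cong[where f = exp]) simp
    finally show ?thesis .
  qed
  have P3: "measure_pmf.prob ?p E3 \<le> 6 * real j * L * exp (- (real j * L / 10))"
  proof -
    have "measure_pmf.prob ?p E3 \<le> 2 * real M0 * exp (- \<beta>)"
      unfolding E3_def
    proof (rule prob_exists_separated_le[OF _ kn _ _ w])
      \<comment> \<open>The overlap degree is at most \<open>q * D\<close>, and
        \<open>D * M0 / N\<close> is at most of order \<open>L\<close>; the factor
        \<open>exp (- (L / (16 * q)))\<close>, a negative power of \<open>n\<close>, absorbs this by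
        \<open>h7\<close>.\<close>
      have "4 * real ((k choose j) * ((n - j) choose (k - j))) * (real M0 / real (n choose k) * exp (- (L / (16 * real q))))
        = 4 * real q * (real D * real M0 / real N) * exp (- (L / (16 * real q)))"
        by (simp add: q(1) D_def N_def)
      also have "\<dots> \<le> 4 * real q * (real j * L / 2) * exp (- (L / (16 * real q)))"
        by (intro mult_right_mono mult_left_mono DM0) auto
      also have "\<dots> \<le> 1" using h7 by (simp add: mult_ac)
      finally show "4 * real ((k choose j) * ((n - j) choose (k - j))) * (real M0 / real (n choose k) * exp (- (L / (16 * real q)))) \<le> 1" .
    qed (use j c2 c4 L T in \<open>auto simp: N_def\<close>)
    also have "\<dots> \<le> 6 * real j * L * exp (- (real j * L / 10))" by (rule P34) (use M0 x1 T0 in linarith)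
    finally show ?thesis .
  qed
  have P4: "measure_pmf.prob ?p E4 \<le> 6 * real j * L * exp (- (real j * L / 10))"
  proof -
    have "measure_pmf.prob ?p E4 \<le> 2 * real M1 * exp (- \<beta>)"
      unfolding E4_def by (rule prob_isolated_edge_between_le[OF _ kn _ w]) (use j c1 c5 q T in \<open>auto simp: N_def\<close>)
    also have "\<dots> \<le> 6 * real j * L * exp (- (real j * L / 10))" by (rule P34) (use M1 x1 T20 in linarith)
    finally show ?thesis .
  qed
  have "measure_pmf.prob ?p {es. tau_C n j es \<noteq> tau_I n j es} \<le> measure_pmf.prob ?p (E1 \<union> E2 \<union> E3 \<union> E4)"
  proof (rule measure_pmf.finite_measure_mono_AE)
    show "AE es in measure_pmf ?p. es \<in> {es. tau_C n j es \<noteq> tau_I n j es} \<longrightarrow> es \<in> E1 \<union> E2 \<union> E3 \<union> E4"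
    proof (rule AE_pmfI, rule impI, rule ccontr)
      fix es assume "es \<in> set_pmf ?p" and ne: "es \<in> {es. tau_C n j es \<noteq> tau_I n j es}"
        and n: "es \<notin> E1 \<union> E2 \<union> E3 \<union> E4"
      then have es: "es \<in> distinct_lists (sets_of_size n k) (n choose k)"
        using set_pmf_first_edges[of "n choose k" n k] by (simp add: hypergraph_process_def)
      have "tau_C n j es = tau_I n j es"
      proof (rule hitting_times_eq[OF j kn es c6])
        show "M1 \<le> n choose k" using c1 by (simp add: N_def)
        show "\<exists>J\<in>sets_of_size n j. isolated (edges_at es M0) J" using n by (simp add: E1_def)
        show "\<forall>J\<in>sets_of_size n j. \<not> isolated (edges_at es M1) J" using n by (simp add: E2_def)
        show "\<not> (\<exists>e\<in>sets_of_size n k. \<exists>C. grown (overlap j) {e} C \<and> separated n k j (edges_at es M0) C)"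
          using n unfolding E3_def by simp
        show "\<forall>t. M0 \<le> t \<and> t < M1 \<longrightarrow> \<not> (\<forall>J. J \<subseteq> es ! t \<and> card J = j \<longrightarrow> isolated (edges_at es t) J)"
          using n unfolding E4_def by simp
      qed
      with ne show False by simp
    qed
  qed simp
  also have "\<dots> \<le> measure_pmf.prob ?p (E1 \<union> E2 \<union> E3) + measure_pmf.prob ?p E4"
    by (rule measure_Un_le) auto
  also have "measure_pmf.prob ?p (E1 \<union> E2 \<union> E3) \<le> measure_pmf.prob ?p (E1 \<union> E2) + measure_pmf.prob ?p E3"
    by (rule measure_Un_le) auto
  also have "measure_pmf.prob ?p (E1 \<union> E2) \<le> measure_pmf.prob ?p E1 + measure_pmf.prob ?p E2"
    by (rule measure_Un_le) auto
  finally show ?thesis using P1 P2 P3 P4 by linarith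
qed

theorem theorem5:
  fixes k j :: nat
  assumes "3 \<le> k" and "1 \<le> j" and "j \<le> k - 1"
  shows "(\<lambda>n. measure_pmf.prob (hypergraph_process k n) {es. tau_C n j es = tau_I n j es})
           \<longlonglongrightarrow> 1"
proof -
  have jk: "j < k" using assms by simp
  define q where "q = k choose j"
  have q3: "3 \<le> q"
  proof -
    have "k \<le> k choose j" using assms(2) jk by (rule le_binomial)
    then show ?thesis using assms by (simp add: q_def)
  qed
  define r where "r = real k - real j"
  have r: "0 < r" using jk by (simp add: r_def)
  have j0: "0 < real j" "1 \<le> real j" and q0: "0 < real q" using assms q3 by auto
  define f where "f n = exp (- real j * ln (real n)) + 12 * real j * ln (real n) * exp (- (real j * ln (real n) / 10))
      + real j ^ j * exp (- (real j * ln (real n) / 4))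
      + (exp (2 * r * real j * ln (real n) / (real n - real j)) - 1)" for n
  have f0: "f \<longlonglongrightarrow> 0"
  proof -
    have a: "(\<lambda>n. exp (- real j * ln (real n))) \<longlonglongrightarrow> 0" using j0 by real_asymp
    have b: "(\<lambda>n. 12 * real j * ln (real n) * exp (- (real j * ln (real n) / 10))) \<longlonglongrightarrow> 0" using j0 by real_asymp
    have c: "(\<lambda>n. exp (- (real j * ln (real n) / 4))) \<longlonglongrightarrow> 0" using j0 by real_asymp
    have d: "(\<lambda>n. exp (2 * r * real j * ln (real n) / (real n - real j)) - 1) \<longlonglongrightarrow> 0" using j0 r by real_asymp
    have "f \<longlonglongrightarrow> 0 + 0 + real j ^ j * 0 + 0"
      unfolding f_def by (intro tendsto_add tendsto_mult tendsto_const a b c d)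
    then show ?thesis by simp
  qed
  have ev: "\<forall>\<^sub>F n in sequentially. measure_pmf.prob (hypergraph_process k n) {es. tau_C n j es \<noteq> tau_I n j es} \<le> f n"
  proof -
    have "\<forall>\<^sub>F n in sequentially. k \<le> n" by (rule eventually_ge_at_top)
    moreover have "\<forall>\<^sub>F n in sequentially. 0 < ln (real n)" by real_asymp
    moreover have "\<forall>\<^sub>F n in sequentially. 4 * real q \<le> real j * ln (real n)" using j0 by real_asymp
    moreover have "\<forall>\<^sub>F n in sequentially. 100 * (18 * real q * real j) * r \<le> real n - real j" by real_asymp
    moreover have "\<forall>\<^sub>F n in sequentially. 6 * real j * ln (real n) * r \<le> real n - real j" using j0 r by real_asymp
    moreover have "\<forall>\<^sub>F n in sequentially. 2 * real q * real j * ln (real n) * exp (- (ln (real n) / (16 * real q))) \<le> 1"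
      using j0 q0 by real_asymp
    moreover have "\<forall>\<^sub>F n in sequentially. 100 * real q * (1 + 18 * real q * real j) \<le> real n / real j" using j0 by real_asymp
    moreover have "\<forall>\<^sub>F n in sequentially. 1 \<le> ln (real n)" by real_asymp
    ultimately show ?thesis
    proof eventually_elim
      case (elim n)
      let ?T = "n choose j"
      have nj: "real n / real j \<ge> 1" using elim(1) jk j0 by (simp add: field_simps)
      \<comment> \<open>The hypotheses involving the binomial coefficient \<open>?T\<close> follow
        from its linear lower bound \<open>n / j\<close>, so that only elementary functions of
        \<open>n\<close> need asymptotics.\<close>
      have "real n / real j \<le> (real n / real j) ^ j" using nj assms by (metis power_increasing power_one_right)
      also have "\<dots> \<le> real ?T" using binomial_ge_n_over_k_pow_k[of j n, where 'a = real] elim(1) jk by simp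
      finally have T: "100 * real q * (1 + 18 * real q * real j) \<le> real ?T" using elim(7) by linarith
      have "1 * real ?T \<le> (real j * ln (real n)) * real ?T"
        using j0 elim(8) mult_mono[of 1 "real j" 1 "ln (real n)"] by (intro mult_right_mono) auto
      then have h4: "100 * real q * (1 + 18 * real q * real j) \<le> real j * ln (real n) * real ?T" using T by linarith
      have "20 * real q * 1 \<le> 100 * real q * (1 + 18 * real q * real j)" using q0 by (intro mult_mono) auto
      then have h5: "20 * real q \<le> real ?T" using T by linarith
      show ?case unfolding f_def r_def
        by (rule prob_hitting_times_ne_le[OF assms(2) jk elim(1) refl elim(2) q_def q3 refl elim(3) elim(4)[unfolded r_def] h4 h5 elim(5)[unfolded r_def] elim(6)])
    qed
  qed
  have compl: "measure_pmf.prob (hypergraph_process k n) {es. tau_C n j es = tau_I n j es}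
      = 1 - measure_pmf.prob (hypergraph_process k n) {es. tau_C n j es \<noteq> tau_I n j es}" for n
  proof -
    have "- {es. tau_C n j es = tau_I n j es} = {es. tau_C n j es \<noteq> tau_I n j es}" by auto
    then show ?thesis
      using measure_pmf.prob_compl[of "{es. tau_C n j es = tau_I n j es}" "hypergraph_process k n"]
      by (simp add: Compl_eq_Diff_UNIV)
  qed
  have "(\<lambda>n. measure_pmf.prob (hypergraph_process k n) {es. tau_C n j es \<noteq> tau_I n j es}) \<longlonglongrightarrow> 0"
    by (rule tendsto_sandwich[OF _ ev tendsto_const f0]) simp
  from tendsto_diff[OF tendsto_const[of 1] this] show ?thesis by (simp add: compl)
qed

end
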